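(* Let $1<p\le q<\infty$, $\alpha>-1$ and $0\le\gamma<2+\alpha$. Let $\sigma,\omega$ be weights and put $u=\sigma^{-p'}$. Then there is a constant $C$ depending only on $p,q,\alpha,\gamma$ such that for all $f$: $$\|\mathcal M_{\alpha,\gamma}(\sigma f)\|_{q,\omega,\alpha}\le C([\sigma,\omega]_{\mathcal A_{p,q,\alpha}})^{1/p}[\sigma]_{\mathcal B_{\infty,\alpha}}^{1/p}\|f\|_{p,\sigma,\alpha},$$ $$\|\mathcal M_{\alpha,\gamma}f\|_{q,\omega,\alpha}\le C[\sigma,\omega]_{\mathcal C_{p,q,\alpha}}[u]_{\mathcal B_{\infty,\alpha}}^{1/p}\|\sigma f\|_{p,\alpha},$$ $$\|\mathcal M_{\alpha,\gamma}(\sigma f)\|_{q,\omega,\alpha}\le C([\sigma,\omega]_{\mathcal S_{p,q,\alpha}})^{1/p}\|f\|_{p,\sigma,\alpha}.$$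
   Context: $\mathcal H=\{x+iy:x\in\mathbb R,\ y>0\}$; for $\alpha>-1$, $dV_\alpha(x+iy)=y^\alpha dx\,dy$. A weight is a nonnegative locally integrable function. $\|g\|_{p,\sigma,\alpha}=(\int_{\mathcal H}|g|^p\sigma dV_\alpha)^{1/p}$, $\|g\|_{p,\alpha}=\|g\|_{p,1,\alpha}$; $p'$ is the conjugate exponent. For $E\subset\mathcal H$, $|E|_{\sigma,\alpha}=\int_E\sigma dV_\alpha$, $|E|_\alpha=\int_EdV_\alpha$. For an interval $I$, $Q_I=\{x+iy:x\in I,0<y<|I|\}$. $\mathcal M_{\alpha,\gamma}f(z)=\sup\{|I|^{-(2+\alpha-\gamma)}\int_{Q_I}|f|dV_\alpha: I\subset\mathbb R\text{ interval}, z\in Q_I\}$, $\mathcal M_\alpha=\mathcal M_{\alpha,0}$, and $[v]_{\mathcal B_{\infty,\alpha}}=\sup_I\frac{1}{|Q_I|_{v,\alpha}}\int_{Q_I}\mathcal M_\alpha(v\chi_{Q_I})dV_\alpha$. The suprema below are over all intervals $I\subset\mathbb R$: $[\sigma,\omega]_{\mathcal A_{p,q,\alpha}}=\sup_I\frac{|Q_I|_{\omega,\alpha}^{p/q}|Q_I|_{\sigma,\alpha}^{p/p'}}{|Q_I|_\alpha^{p(1-\frac{\gamma}{2+\alpha})}}$; $[\sigma,\omega]_{\mathcal C_{p,q,\alpha}}=\sup_I|Q_I|_\alpha^{\frac{\gamma}{2+\alpha}-1}\left(\int_{Q_I}\omega dV_\alpha\right)^{1/q}\left(\int_{Q_I}\sigma^{-p'}dV_\alpha\right)^{1/p'}$;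 $[\sigma,\omega]_{\mathcal S_{p,q,\alpha}}=\sup_I\frac{|Q_I|_{\omega,\alpha}^{p/q}|Q_I|_{\sigma,\alpha}^{p}}{|Q_I|_\alpha^{p(1-\frac{\gamma}{2+\alpha})+1}}\exp\left(\frac1{|Q_I|_\alpha}\int_{Q_I}\log\sigma^{-1}dV_\alpha\right)$. *)

theory Defs
  imports "HOL-Analysis.Analysis"
begin

definition UHP :: "complex set" where
  "UHP = {z. 0 < Im z}"

definition Vol :: "real \<Rightarrow> complex measure" where
  "Vol \<alpha> = density lborel (\<lambda>z. ennreal (indicator UHP z * Im z powr \<alpha>))"

definition Qbox :: "real \<Rightarrow> real \<Rightarrow> complex set" where
  "Qbox a b = {z. a \<le> Re z \<and> Re z \<le> b \<and> 0 < Im z \<and> Im z < b - a}"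

definition Ivs :: "(real \<times> real) set" where
  "Ivs = {(a, b). a < b}"

text \<open>Powers of extended nonnegative reals (used only with positive exponent).\<close>
definition epowr :: "ennreal \<Rightarrow> real \<Rightarrow> ennreal" where
  "epowr x r = (if x = top then top else ennreal (enn2real x powr r))"

definition conj_exp :: "real \<Rightarrow> real" where
  "conj_exp p = p / (p - 1)"

definition wmeas :: "real \<Rightarrow> (complex \<Rightarrow> ennreal) \<Rightarrow> complex set \<Rightarrow> ennreal" where
  "wmeas \<alpha> v E = (\<integral>\<^sup>+ z\<in>E. v z \<partial>Vol \<alpha>)"

text \<open>Unweighted measure |E|_alpha, as a real number (finite on Carleson boxes).\<close>
definition volA :: "real \<Rightarrow> complex set \<Rightarrow> real" where
  "volA \<alpha> E = enn2real (emeasure (Vol \<alpha>) E)"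

definition wnorm :: "real \<Rightarrow> real \<Rightarrow> (complex \<Rightarrow> ennreal) \<Rightarrow> (complex \<Rightarrow> ennreal) \<Rightarrow> ennreal" where
  "wnorm p \<alpha> w g = epowr (\<integral>\<^sup>+ z. epowr (g z) p * w z \<partial>Vol \<alpha>) (1 / p)"

definition maxfun :: "real \<Rightarrow> real \<Rightarrow> (complex \<Rightarrow> ennreal) \<Rightarrow> complex \<Rightarrow> ennreal" where
  "maxfun \<alpha> \<gamma> g z =
     (SUP ab \<in> {(a, b). a < b \<and> z \<in> Qbox a b}.
        ennreal ((snd ab - fst ab) powr (- (2 + \<alpha> - \<gamma>))) *
        (\<integral>\<^sup>+ w\<in>Qbox (fst ab) (snd ab). g w \<partial>Vol \<alpha>))"

definition is_weight :: "(complex \<Rightarrow> real) \<Rightarrow> bool" where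
  "is_weight w \<longleftrightarrow> w \<in> borel_measurable borel \<and> (\<forall>z. 0 \<le> w z) \<and>
     (\<forall>K. compact K \<and> K \<subseteq> UHP \<longrightarrow> (\<integral>\<^sup>+ z\<in>K. ennreal (w z) \<partial>lborel) < top)"

definition uw :: "real \<Rightarrow> (complex \<Rightarrow> real) \<Rightarrow> complex \<Rightarrow> ennreal" where
  "uw p \<sigma> z = (if \<sigma> z = 0 then top else ennreal (\<sigma> z powr (- conj_exp p)))"

definition Binf :: "real \<Rightarrow> (complex \<Rightarrow> ennreal) \<Rightarrow> ennreal" where
  "Binf \<alpha> v = (SUP ab \<in> Ivs.
     (\<integral>\<^sup>+ z\<in>Qbox (fst ab) (snd ab).
         maxfun \<alpha> 0 (\<lambda>w. v w * indicator (Qbox (fst ab) (snd ab)) w) z \<partial>Vol \<alpha>)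
     / wmeas \<alpha> v (Qbox (fst ab) (snd ab)))"

definition Achar :: "real \<Rightarrow> real \<Rightarrow> real \<Rightarrow> real \<Rightarrow> (complex \<Rightarrow> real) \<Rightarrow> (complex \<Rightarrow> real) \<Rightarrow> ennreal" where
  "Achar p q \<alpha> \<gamma> \<sigma> \<omega> = (SUP ab \<in> Ivs.
     epowr (wmeas \<alpha> (\<lambda>z. ennreal (\<omega> z)) (Qbox (fst ab) (snd ab))) (p / q) *
     epowr (wmeas \<alpha> (\<lambda>z. ennreal (\<sigma> z)) (Qbox (fst ab) (snd ab))) (p / conj_exp p) /
     ennreal (volA \<alpha> (Qbox (fst ab) (snd ab)) powr (p * (1 - \<gamma> / (2 + \<alpha>)))))"

definition Cchar :: "real \<Rightarrow> real \<Rightarrow> real \<Rightarrow> real \<Rightarrow> (complex \<Rightarrow> real) \<Rightarrow> (complex \<Rightarrow> real) \<Rightarrow> ennreal" where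
  "Cchar p q \<alpha> \<gamma> \<sigma> \<omega> = (SUP ab \<in> Ivs.
     ennreal (volA \<alpha> (Qbox (fst ab) (snd ab)) powr (\<gamma> / (2 + \<alpha>) - 1)) *
     epowr (wmeas \<alpha> (\<lambda>z. ennreal (\<omega> z)) (Qbox (fst ab) (snd ab))) (1 / q) *
     epowr (wmeas \<alpha> (uw p \<sigma>) (Qbox (fst ab) (snd ab))) (1 / conj_exp p))"

text \<open>exp of the dV_alpha-average of log(1/sigma) over E, computed from the positive and
  negative parts of log(1/sigma) (log(1/0) = infinity); value infinity if either part has
  infinite integral.\<close>
definition geom_inv :: "real \<Rightarrow> (complex \<Rightarrow> real) \<Rightarrow> complex set \<Rightarrow> ennreal" where
  "geom_inv \<alpha> \<sigma> E =
     (let P = (\<integral>\<^sup>+ z\<in>E. (if \<sigma> z = 0 then top else ennreal (max 0 (- ln (\<sigma> z)))) \<partial>Vol \<alpha>);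
          N = (\<integral>\<^sup>+ z\<in>E. (if \<sigma> z = 0 then 0 else ennreal (max 0 (ln (\<sigma> z)))) \<partial>Vol \<alpha>)
      in if P = top \<or> N = top then top
         else ennreal (exp ((enn2real P - enn2real N) / volA \<alpha> E)))"

definition Schar :: "real \<Rightarrow> real \<Rightarrow> real \<Rightarrow> real \<Rightarrow> (complex \<Rightarrow> real) \<Rightarrow> (complex \<Rightarrow> real) \<Rightarrow> ennreal" where
  "Schar p q \<alpha> \<gamma> \<sigma> \<omega> = (SUP ab \<in> Ivs.
     epowr (wmeas \<alpha> (\<lambda>z. ennreal (\<omega> z)) (Qbox (fst ab) (snd ab))) (p / q) *
     epowr (wmeas \<alpha> (\<lambda>z. ennreal (\<sigma> z)) (Qbox (fst ab) (snd ab))) p /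
     ennreal (volA \<alpha> (Qbox (fst ab) (snd ab)) powr (p * (1 - \<gamma> / (2 + \<alpha>)) + 1)) *
     geom_inv \<alpha> \<sigma> (Qbox (fst ab) (snd ab)))"

end

theory Submission
  imports Defs
begin

text \<open>
  Every interval lies in a cell of comparable length of one of two dyadic grids, so the maximal
  function is dominated pointwise by the sum, over all Carleson boxes of the two grids, of the
  averages that occur in it. Because the upper halves of the boxes of one grid are disjoint and
  fill a fixed proportion of the boxes, the whole grid is already sparse, and replacing the
  supremum by a sum costs only a constant. Passing from \<open>q\<close>-th to \<open>p\<close>-th powers and inserting the
  two-weight characteristic leaves a sum that the Carleson embedding theorem for the measure
  \<open>\<sigma> dV\<close> controls. Its packing condition for the masses \<open>\<sigma>(Q)\<close> is what the
  \<open>B\<^sub>\<infinity>\<close> constant expresses. For the logarithmic characteristic the masses are replaced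
  by \<open>|Q| exp (avg log \<sigma>) \<le> |Q| (avg \<surd>\<sigma>)\<^sup>2\<close>, whose packing condition is again an instance of
  the embedding theorem, now for \<open>dV\<close> and \<open>p = 2\<close>. The second estimate is the first one with
  \<open>u\<close> and \<open>f / u\<close> in place of \<open>\<sigma>\<close> and \<open>f\<close>.
\<close>

section \<open>Powers of extended nonnegative reals\<close>

text \<open>A weight is integrable on compact subsets of the open half-plane, whereas Carleson boxes
  reach its boundary, so a box may have infinite mass. Everything is therefore computed in
  \<open>ennreal\<close>, and the estimates run over the cells of nonzero
  \<open>\<omega>\<close>-mass: the other terms of the sum vanish, and on these a finite
  characteristic forces the mass of \<open>\<sigma>\<close> (or of \<open>u\<close>) to be finite.
  The maximal function is a supremum over uncountably many boxes; it enters integrals through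
  monotonicity alone, so its measurability is never at issue. The embedding theorem is proved for
  finite families, in which every set lies in a maximal one. Its bound does not depend on the
  family, so it passes to sums over a whole grid.\<close>

lemma epowr_ennreal [simp]: "0 \<le> x \<Longrightarrow> epowr (ennreal x) r = ennreal (x powr r)"
  by (simp add: epowr_def)

lemma epowr_top [simp]: "epowr top r = top"
  by (simp add: epowr_def)

lemma epowr_0 [simp]: "epowr 0 r = 0"
  by (simp add: epowr_def)

lemma epowr_1 [simp]: "epowr x 1 = x"
  by (cases x) (auto simp: epowr_def)

lemma epowr_eq_0_iff [simp]: "epowr x r = 0 \<longleftrightarrow> x = 0"
  by (cases x) (auto simp: epowr_def ennreal_eq_0_iff)

lemma epowr_eq_top_iff [simp]: "epowr x r = top \<longleftrightarrow> x = top"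
  by (auto simp: epowr_def)

lemma epowr_less_top_iff [simp]: "epowr x r < top \<longleftrightarrow> x < top"
  by (simp add: less_top[symmetric])

lemma epowr_mono: "x \<le> y \<Longrightarrow> 0 \<le> r \<Longrightarrow> epowr x r \<le> epowr y r"
  by (cases x; cases y) (auto simp: top_unique intro!: ennreal_leI powr_mono2)

text \<open>0 and \<open>top\<close> are fixed by every exponent and \<open>0 * top = 0\<close>, so
  this law and the next two hold with no condition on the exponents.\<close>

lemma epowr_mult: "epowr (x * y) r = epowr x r * epowr y r"
proof (cases x; cases y)
  fix a b assume "x = ennreal a" "0 \<le> a" "y = ennreal b" "0 \<le> b"
  then show ?thesis
    by (simp add: ennreal_mult[symmetric] powr_mult)
qed (auto simp: ennreal_mult_eq_top_iff ennreal_top_mult ennreal_mult_top ennreal_eq_0_iff)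

lemma epowr_add: "epowr x (r + s) = epowr x r * epowr x s"
  by (cases x) (auto simp: powr_add ennreal_mult ennreal_mult_top)

lemma epowr_epowr [simp]: "epowr (epowr x r) s = epowr x (r * s)"
  by (cases x) (auto simp: powr_powr)

lemma borel_measurable_epowr [measurable (raw)]:
  assumes [measurable]: "f \<in> borel_measurable M"
  shows "(\<lambda>x. epowr (f x) r) \<in> borel_measurable M"
  unfolding epowr_def by measurable

text \<open>With r = q / p this is the passage from q-th to p-th powers, and the place where p \<le>
  q enters. Of the r factors \<open>y i\<close>, r - 1 are replaced by the whole sum and one is kept
  to be summed.\<close>

lemma epowr_sum_le:
  assumes "finite F" "1 \<le> r"
  shows "(\<Sum>i\<in>F. epowr (y i) r) \<le> epowr (\<Sum>i\<in>F. y i) r"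
proof -
  define S where "S = (\<Sum>i\<in>F. y i)"
  have le: "y i \<le> S" if "i \<in> F" for i
    unfolding S_def using assms that by (intro member_le_sum) auto
  have "(\<Sum>i\<in>F. epowr (y i) r) \<le> (\<Sum>i\<in>F. y i * epowr S (r - 1))"
  proof (intro sum_mono)
    fix i assume "i \<in> F"
    have "epowr (y i) r = epowr (y i) (1 + (r - 1))" by simp
    also have "\<dots> = y i * epowr (y i) (r - 1)" by (subst epowr_add) simp
    also have "\<dots> \<le> y i * epowr S (r - 1)"
      using assms le[OF \<open>i \<in> F\<close>] by (intro mult_left_mono epowr_mono) auto
    finally show "epowr (y i) r \<le> y i * epowr S (r - 1)" .
  qed
  also have "\<dots> = epowr S (1 + (r - 1))"
    by (subst epowr_add) (simp add: S_def sum_distrib_right)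
  finally show ?thesis by (simp add: S_def)
qed

text \<open>The layer cake formula. It is needed for a = p - 1 and for a = p - 2; the latter may be
  negative, hence the range a > -1.\<close>

lemma nn_integral_powr_layer:
  assumes a: "-1 < a"
  shows "(\<integral>\<^sup>+ t. ennreal (t powr a) * indicator {t. 0 \<le> t \<and> ennreal t \<le> x} t \<partial>lborel)
         = epowr x (a + 1) * ennreal (1 / (a + 1))"
proof -
  have fin: "(\<integral>\<^sup>+ t. ennreal (t powr a) * indicator {0..c} t \<partial>lborel)
      = ennreal (c powr (a + 1) * (1 / (a + 1)))" if "0 \<le> c" for c
  proof -
    have "((\<lambda>t. indicator {0..c} t * t powr a) has_integral (c powr (a + 1) / (a + 1))) UNIV"
    proof -
      have "((\<lambda>t. if t \<in> {0..c} then t powr a else 0) has_integral (c powr (a + 1) / (a + 1))) UNIV"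
        using has_integral_powr_from_0[OF a that] by (subst has_integral_restrict_UNIV) simp
      also have "(\<lambda>t. if t \<in> {0..c} then t powr a else 0) = (\<lambda>t. indicator {0..c} t * t powr a)"
        by (auto simp: fun_eq_iff)
      finally show ?thesis .
    qed
    then have "(\<integral>\<^sup>+ t. ennreal (indicator {0..c} t * t powr a) \<partial>lborel) = ennreal (c powr (a + 1) / (a + 1))"
      using a by (intro nn_integral_has_integral_lborel) auto
    then show ?thesis
      by (simp add: ennreal_mult' ennreal_indicator mult.commute)
  qed
  show ?thesis
  proof (cases x)
    case (real c)
    have "{t. 0 \<le> t \<and> ennreal t \<le> x} = {0..c}" using real by auto
    with fin[OF real(1)] real a show ?thesis by (simp add: ennreal_mult'[symmetric])
  next
    case top
    define I where "I = (\<integral>\<^sup>+ t. ennreal (t powr a) * indicator {t. 0 \<le> t \<and> ennreal t \<le> x} t \<partial>lborel)"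
    have "ennreal b \<le> I" for b
    proof -
      \<comment> \<open>Chosen so that the integral over \<open>{0..c}\<close> equals
        \<open>max b 0\<close>; hence the full integral exceeds every bound.\<close>
      define c where "c = (max b 0 * (a + 1)) powr (1 / (a + 1))"
      have "ennreal b \<le> ennreal (c powr (a + 1) * (1 / (a + 1)))"
        using a by (intro ennreal_leI) (simp add: c_def powr_powr)
      also have "\<dots> = (\<integral>\<^sup>+ t. ennreal (t powr a) * indicator {0..c} t \<partial>lborel)"
        by (rule fin[symmetric]) (simp add: c_def)
      also have "\<dots> \<le> I"
        unfolding I_def using top by (intro nn_integral_mono mult_left_mono) (auto split: split_indicator)
      finally show ?thesis .
    qed
    then have "I = top"
    proof (cases I)
      case (real r)
      with \<open>\<And>b. ennreal b \<le> I\<close>[of "r + 1"] show ?thesis by simp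
    qed
    then show ?thesis using top a by (simp add: I_def ennreal_top_mult ennreal_eq_0_iff)
  qed
qed

section \<open>The Carleson embedding theorem\<close>

text \<open>The maximal sets of a laminar family are disjoint, and the packing condition at each of
  them pays for all the sets inside it. What remains is Chebyshev's inequality, sharpened by
  discarding the points where f is below t / 2.\<close>

lemma carleson_weak_type:
  fixes v f :: "'a \<Rightarrow> ennreal" and a :: "'a set \<Rightarrow> ennreal" and t :: real
  assumes [measurable]: "v \<in> borel_measurable M" "f \<in> borel_measurable M"
    and "finite F" and sets: "F \<subseteq> sets M"
    and laminar: "\<And>A B. A \<in> F \<Longrightarrow> B \<in> F \<Longrightarrow> A \<subseteq> B \<or> B \<subseteq> A \<or> A \<inter> B = {}"
    and fin: "\<And>A. A \<in> F \<Longrightarrow> (\<integral>\<^sup>+x\<in>A. v x \<partial>M) < top"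
    and carleson: "\<And>A. A \<in> F \<Longrightarrow> (\<Sum>B | B \<in> F \<and> B \<subseteq> A. a B) \<le> K * (\<integral>\<^sup>+x\<in>A. v x \<partial>M)"
    and "0 \<le> t" and large: "\<And>A. A \<in> F \<Longrightarrow> ennreal t * (\<integral>\<^sup>+x\<in>A. v x \<partial>M) \<le> (\<integral>\<^sup>+x\<in>A. f x * v x \<partial>M)"
  shows "ennreal t * (\<Sum>A\<in>F. a A)
    \<le> 2 * K * (\<integral>\<^sup>+x. f x * v x * indicator {x. ennreal t \<le> 2 * f x} x \<partial>M)"
proof -
  define \<nu> where "\<nu> A = (\<integral>\<^sup>+x\<in>A. v x \<partial>M)" for A
  define E where "E = {x. ennreal t \<le> 2 * f x}"
  define G where "G = {A \<in> F. \<forall>B\<in>F. A \<subseteq> B \<longrightarrow> A = B}"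
  have G: "G \<subseteq> F" "finite G" using \<open>finite F\<close> by (auto simp: G_def)
  have disj: "disjoint_family_on (\<lambda>A. A) G"
    unfolding disjoint_family_on_def
  proof (intro ballI impI)
    fix A B assume "A \<in> G" "B \<in> G" "A \<noteq> B"
    then show "A \<inter> B = {}" using laminar[of A B] unfolding G_def by blast
  qed
  have maximal: "\<exists>B\<in>G. A \<subseteq> B" if "A \<in> F" for A
    using finite_has_maximal2[OF \<open>finite F\<close> that] by (auto simp: G_def)
  \<comment> \<open>Where 2 f < t the integrand f v is below t v / 2, so that part uses at most half
    of \<open>ennreal t * \<nu> A\<close> and can be absorbed into the left side; the rest lives on
    \<open>E\<close>.\<close>
  have half: "ennreal t * \<nu> A \<le> 2 * (\<integral>\<^sup>+x\<in>A. f x * v x * indicator E x \<partial>M)" if "A \<in> F" for A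
  proof -
    have [measurable]: "A \<in> sets M" using sets that by auto
    have "2 * (ennreal t * \<nu> A) \<le> 2 * (\<integral>\<^sup>+x\<in>A. f x * v x \<partial>M)"
      using large[OF that] by (intro mult_left_mono) (auto simp: \<nu>_def)
    also have "\<dots> = (\<integral>\<^sup>+x\<in>A. 2 * f x * v x \<partial>M)"
      by (subst nn_integral_cmult[symmetric]) (auto simp: mult.assoc)
    also have "\<dots> \<le> (\<integral>\<^sup>+x. ennreal t * (v x * indicator A x)
        + 2 * (f x * v x * indicator E x * indicator A x) \<partial>M)"
    proof (intro nn_integral_mono)
      fix x show "2 * f x * v x * indicator A x \<le> ennreal t * (v x * indicator A x)
          + 2 * (f x * v x * indicator E x * indicator A x)"
      proof (cases "ennreal t \<le> 2 * f x")
        case True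
        then show ?thesis by (simp add: E_def mult.assoc split: split_indicator)
      next
        case False
        then have "2 * f x * (v x * indicator A x) \<le> ennreal t * (v x * indicator A x)"
          by (intro mult_right_mono) auto
        then show ?thesis using False by (simp add: E_def mult.assoc)
      qed
    qed
    also have "\<dots> = ennreal t * \<nu> A + 2 * (\<integral>\<^sup>+x\<in>A. f x * v x * indicator E x \<partial>M)"
      unfolding E_def \<nu>_def by (subst nn_integral_add) (auto simp: nn_integral_cmult)
    finally have "ennreal t * \<nu> A + ennreal t * \<nu> A \<le>
        ennreal t * \<nu> A + 2 * (\<integral>\<^sup>+x\<in>A. f x * v x * indicator E x \<partial>M)"
      by (simp only: mult_2)
    \<comment> \<open>The absorption is a subtraction, which is legitimate only for a finite
      quantity.\<close>
    moreover have "ennreal t * \<nu> A \<noteq> top"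
      using fin[OF that] by (simp add: \<nu>_def ennreal_mult_eq_top_iff)
    ultimately show ?thesis
      by (simp add: ennreal_add_left_cancel_le)
  qed
  \<comment> \<open>\<open>g\<close> assigns to each set one maximal set above it, so the sum over
    \<open>F\<close> splits into groups indexed by \<open>G\<close>.\<close>
  obtain g where g: "g A \<in> G" "A \<subseteq> g A" if "A \<in> F" for A
    using maximal by metis
  have "(\<Sum>A\<in>F. a A) = (\<Sum>B\<in>G. \<Sum>A | A \<in> F \<and> g A = B. a A)"
    using \<open>finite F\<close> G g by (intro sum.group[symmetric]) auto
  also have "\<dots> \<le> (\<Sum>B\<in>G. \<Sum>A | A \<in> F \<and> A \<subseteq> B. a A)"
    using \<open>finite F\<close> g by (intro sum_mono sum_mono2) auto
  also have "\<dots> \<le> (\<Sum>B\<in>G. K * \<nu> B)"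
    using carleson G by (intro sum_mono) (auto simp: \<nu>_def)
  finally have "ennreal t * (\<Sum>A\<in>F. a A) \<le> ennreal t * (\<Sum>B\<in>G. K * \<nu> B)"
    by (intro mult_left_mono) auto
  also have "\<dots> = K * (\<Sum>B\<in>G. ennreal t * \<nu> B)"
    by (simp add: sum_distrib_left mult_ac)
  also have "\<dots> \<le> K * (\<Sum>B\<in>G. 2 * (\<integral>\<^sup>+x\<in>B. f x * v x * indicator E x \<partial>M))"
    using half G by (intro mult_left_mono sum_mono) auto
  also have "\<dots> = 2 * K * (\<Sum>B\<in>G. (\<integral>\<^sup>+x\<in>B. f x * v x * indicator E x \<partial>M))"
    by (simp add: sum_distrib_left mult_ac)
  also have "(\<Sum>B\<in>G. (\<integral>\<^sup>+x\<in>B. f x * v x * indicator E x \<partial>M))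
     = (\<integral>\<^sup>+x. (\<Sum>B\<in>G. f x * v x * indicator E x * indicator B x) \<partial>M)"
    using G sets unfolding E_def by (intro nn_integral_sum[symmetric]) auto
  also have "\<dots> \<le> (\<integral>\<^sup>+x. f x * v x * indicator E x \<partial>M)"
  proof (intro nn_integral_mono)
    fix x
    have "(\<Sum>B\<in>G. f x * v x * indicator E x * indicator B x)
      = f x * v x * indicator E x * indicator (\<Union>B\<in>G. B) x"
      using disj G by (subst indicator_UN_disjoint) (auto simp: sum_distrib_left)
    also have "\<dots> \<le> f x * v x * indicator E x" by (auto split: split_indicator)
    finally show "(\<Sum>B\<in>G. f x * v x * indicator E x * indicator B x) \<le> f x * v x * indicator E x" .
  qed
  finally show ?thesis by (simp add: E_def mult_left_mono)
qed

text \<open>Integrates the weak estimate against p t^(p-1) dt and exchanges the integrals. The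
  restriction to t \<le> 2 f makes the inner integral of t^(p-2) finite at the upper end, and p > 1
  makes it finite at 0. The constant is 2 p from the weak estimate and the layer cake formula, times
  2^(p-1) / (p - 1) from the inner integral.\<close>

theorem carleson_embedding:
  fixes v f :: "'a \<Rightarrow> ennreal" and a :: "'a set \<Rightarrow> ennreal" and p :: real
  assumes M: "sigma_finite_measure M"
    and [measurable]: "v \<in> borel_measurable M" "f \<in> borel_measurable M"
    and "finite F" and sets: "F \<subseteq> sets M"
    and laminar: "\<And>A B. A \<in> F \<Longrightarrow> B \<in> F \<Longrightarrow> A \<subseteq> B \<or> B \<subseteq> A \<or> A \<inter> B = {}"
    and fin: "\<And>A. A \<in> F \<Longrightarrow> (\<integral>\<^sup>+x\<in>A. v x \<partial>M) < top"
    and carleson: "\<And>A. A \<in> F \<Longrightarrow> (\<Sum>B | B \<in> F \<and> B \<subseteq> A. a B) \<le> K * (\<integral>\<^sup>+x\<in>A. v x \<partial>M)"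
    and p: "1 < p"
  shows "(\<Sum>A\<in>F. a A * epowr ((\<integral>\<^sup>+x\<in>A. f x * v x \<partial>M) / (\<integral>\<^sup>+x\<in>A. v x \<partial>M)) p)
    \<le> ennreal (2 powr p * p / (p - 1)) * K * (\<integral>\<^sup>+x. epowr (f x) p * v x \<partial>M)"
proof -
  interpret sigma_finite_measure M by fact
  interpret pair_sigma_finite M lborel ..
  define avg where "avg A = (\<integral>\<^sup>+x\<in>A. f x * v x \<partial>M) / (\<integral>\<^sup>+x\<in>A. v x \<partial>M)" for A
  define \<Phi> where "\<Phi> t = (\<integral>\<^sup>+x. f x * v x * indicator {x. ennreal t \<le> 2 * f x} x \<partial>M)" for t
  have weak: "ennreal t * (\<Sum>A\<in>F. a A * indicator {t. ennreal t \<le> avg A} t) \<le> 2 * K * \<Phi> t"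
    if "0 \<le> t" for t
  proof -
    have "ennreal t * (\<Sum>A | A \<in> F \<and> ennreal t \<le> avg A. a A) \<le> 2 * K * \<Phi> t"
      unfolding \<Phi>_def
    proof (rule carleson_weak_type)
      fix A assume "A \<in> {A. A \<in> F \<and> ennreal t \<le> avg A}"
      then have A: "A \<in> F" "ennreal t \<le> avg A" by auto
      have "(\<Sum>B | B \<in> {A. A \<in> F \<and> ennreal t \<le> avg A} \<and> B \<subseteq> A. a B) \<le> (\<Sum>B | B \<in> F \<and> B \<subseteq> A. a B)"
        using \<open>finite F\<close> by (intro sum_mono2) auto
      with carleson[OF A(1)]
      show "(\<Sum>B | B \<in> {A. A \<in> F \<and> ennreal t \<le> avg A} \<and> B \<subseteq> A. a B) \<le> K * (\<integral>\<^sup>+x\<in>A. v x \<partial>M)"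
        by simp
      show "ennreal t * (\<integral>\<^sup>+x\<in>A. v x \<partial>M) \<le> (\<integral>\<^sup>+x\<in>A. f x * v x \<partial>M)"
      proof (cases "(\<integral>\<^sup>+x\<in>A. v x \<partial>M) = 0")
        case False
        have "ennreal t * (\<integral>\<^sup>+x\<in>A. v x \<partial>M) \<le> avg A * (\<integral>\<^sup>+x\<in>A. v x \<partial>M)"
          using A by (intro mult_right_mono) auto
        also have "\<dots> = (\<integral>\<^sup>+x\<in>A. f x * v x \<partial>M)"
          unfolding avg_def using False fin[OF A(1)] by (simp add: ennreal_divide_times)
        finally show ?thesis .
      qed simp
    qed (use assms that in auto)
    also have "(\<Sum>A | A \<in> F \<and> ennreal t \<le> avg A. a A) = (\<Sum>A\<in>F. a A * indicator {t. ennreal t \<le> avg A} t)"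
      unfolding sum.inter_filter[OF \<open>finite F\<close>] by (intro sum.cong) auto
    finally show ?thesis .
  qed
  have "(\<Sum>A\<in>F. a A * epowr (avg A) p) =
      (\<Sum>A\<in>F. a A * (ennreal p * (\<integral>\<^sup>+ t. ennreal (t powr (p - 1)) * indicator {t. 0 \<le> t \<and> ennreal t \<le> avg A} t \<partial>lborel)))"
  proof (intro sum.cong refl)
    fix A
    show "a A * epowr (avg A) p = a A * (ennreal p * (\<integral>\<^sup>+ t. ennreal (t powr (p - 1)) * indicator {t. 0 \<le> t \<and> ennreal t \<le> avg A} t \<partial>lborel))"
      using p by (subst nn_integral_powr_layer) (auto simp: mult.left_commute[of "ennreal p"] ennreal_mult'[symmetric])
  qed
  also have "\<dots> = (\<integral>\<^sup>+ t. (\<Sum>A\<in>F. a A * (ennreal p * (ennreal (t powr (p - 1)) * indicator {t. 0 \<le> t \<and> ennreal t \<le> avg A} t))) \<partial>lborel)"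
    by (simp add: nn_integral_sum nn_integral_cmult)
  also have "\<dots> \<le> (\<integral>\<^sup>+ t. ennreal (2 * p) * K * (ennreal (t powr (p - 2)) * indicator {0..} t * \<Phi> t) \<partial>lborel)"
  proof (intro nn_integral_mono)
    fix t :: real
    show "(\<Sum>A\<in>F. a A * (ennreal p * (ennreal (t powr (p - 1)) * indicator {t. 0 \<le> t \<and> ennreal t \<le> avg A} t)))
      \<le> ennreal (2 * p) * K * (ennreal (t powr (p - 2)) * indicator {0..} t * \<Phi> t)"
    proof (cases "0 \<le> t")
      case True
      \<comment> \<open>One factor t is split off for the weak estimate. At t = 0 both sides are 0
        because \<open>0 powr r = 0\<close>.\<close>
      have e: "t powr (p - 1) = t powr (p - 2) * t"
        using True by (cases "t = 0") (auto simp: powr_mult_base mult.commute)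
      have "(\<Sum>A\<in>F. a A * (ennreal p * (ennreal (t powr (p - 1)) * indicator {t. 0 \<le> t \<and> ennreal t \<le> avg A} t)))
        = ennreal p * ennreal (t powr (p - 2)) * (ennreal t * (\<Sum>A\<in>F. a A * indicator {t. ennreal t \<le> avg A} t))"
        using True by (simp add: e ennreal_mult sum_distrib_left mult_ac indicator_def)
      also have "\<dots> \<le> ennreal p * ennreal (t powr (p - 2)) * (2 * K * \<Phi> t)"
        by (intro mult_left_mono weak True) auto
      also have "\<dots> = ennreal (2 * p) * K * (ennreal (t powr (p - 2)) * indicator {0..} t * \<Phi> t)"
        using True p by (simp add: ennreal_mult mult_ac)
      finally show ?thesis .
    qed auto
  qed
  also have "\<dots> = ennreal (2 * p) * K * (\<integral>\<^sup>+ t. (\<integral>\<^sup>+x. ennreal (t powr (p - 2)) * indicator {0..} t *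
      (f x * v x * indicator {x. ennreal t \<le> 2 * f x} x) \<partial>M) \<partial>lborel)"
    unfolding \<Phi>_def by (simp add: nn_integral_cmult)
  also have "(\<integral>\<^sup>+ t. (\<integral>\<^sup>+x. ennreal (t powr (p - 2)) * indicator {0..} t *
      (f x * v x * indicator {x. ennreal t \<le> 2 * f x} x) \<partial>M) \<partial>lborel)
    = (\<integral>\<^sup>+ x. (\<integral>\<^sup>+t. ennreal (t powr (p - 2)) * indicator {0..} t *
      (f x * v x * indicator {x. ennreal t \<le> 2 * f x} x) \<partial>lborel) \<partial>M)"
    by (rule Fubini') measurable
  also have "\<dots> = (\<integral>\<^sup>+ x. f x * v x * (\<integral>\<^sup>+t. ennreal (t powr (p - 2)) * indicator {t. 0 \<le> t \<and> ennreal t \<le> 2 * f x} t \<partial>lborel) \<partial>M)"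
    by (subst nn_integral_cmult[symmetric]) (auto intro!: nn_integral_cong simp: indicator_def mult.commute)
  also have "\<dots> = (\<integral>\<^sup>+ x. ennreal (2 powr (p - 1) / (p - 1)) * (epowr (f x) p * v x) \<partial>M)"
  proof (intro nn_integral_cong)
    fix x
    have "epowr (f x) p = f x * epowr (f x) (p - 1)"
      using epowr_add[of "f x" 1 "p - 1"] by simp
    moreover have "(\<integral>\<^sup>+t. ennreal (t powr (p - 2)) * indicator {t. 0 \<le> t \<and> ennreal t \<le> 2 * f x} t \<partial>lborel)
        = ennreal (2 powr (p - 1) / (p - 1)) * epowr (f x) (p - 1)"
      using p by (subst nn_integral_powr_layer)
        (auto simp: epowr_mult divide_inverse ennreal_mult mult_ac ennreal_numeral[symmetric] simp del: ennreal_numeral)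
    ultimately show "f x * v x * (\<integral>\<^sup>+t. ennreal (t powr (p - 2)) * indicator {t. 0 \<le> t \<and> ennreal t \<le> 2 * f x} t \<partial>lborel)
      = ennreal (2 powr (p - 1) / (p - 1)) * (epowr (f x) p * v x)"
      by (simp add: mult_ac)
  qed
  also have "\<dots> = ennreal (2 powr (p - 1) / (p - 1)) * (\<integral>\<^sup>+ x. epowr (f x) p * v x \<partial>M)"
    by (intro nn_integral_cmult) auto
  also have "ennreal (2 * p) * K * \<dots> = ennreal (2 powr p * p / (p - 1)) * K * (\<integral>\<^sup>+ x. epowr (f x) p * v x \<partial>M)"
  proof -
    have "2 * p * (2 powr (p - 1) / (p - 1)) = 2 powr p * p / (p - 1)"
      using powr_add[of 2 1 "p - 1"] by (simp add: field_simps)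
    then have "ennreal (2 * p) * ennreal (2 powr (p - 1) / (p - 1)) = ennreal (2 powr p * p / (p - 1))"
      using p by (simp flip: ennreal_mult)
    then show ?thesis
      by (simp only: mult.assoc mult.left_commute[of K] flip: mult.assoc[of "ennreal (2 * p)"])
  qed
  finally show ?thesis unfolding avg_def .
qed

section \<open>Carleson boxes\<close>

text \<open>Half-open on the right, unlike \<open>Qbox\<close>, so that adjacent boxes of one size
  are disjoint; the two differ by a vertical segment, a null set.\<close>

definition Dbox :: "real \<Rightarrow> real \<Rightarrow> complex set" where
  "Dbox a h = {z. a \<le> Re z \<and> Re z < a + h \<and> 0 < Im z \<and> Im z < h}"

definition Tbox :: "real \<Rightarrow> real \<Rightarrow> complex set" where
  "Tbox a h = {z. a \<le> Re z \<and> Re z < a + h \<and> h / 2 \<le> Im z \<and> Im z < h}"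

lemma measurable_Dbox [measurable]: "Dbox a h \<in> sets borel"
  unfolding Dbox_def by measurable

lemma measurable_Tbox [measurable]: "Tbox a h \<in> sets borel"
  unfolding Tbox_def by measurable

lemma measurable_Qbox [measurable]: "Qbox a b \<in> sets borel"
  unfolding Qbox_def by measurable

lemma measurable_UHP [measurable]: "UHP \<in> sets borel"
  unfolding UHP_def by measurable

lemma sets_Vol [simp, measurable_cong]: "sets (Vol \<alpha>) = sets borel"
  by (simp add: Vol_def)

lemma space_Vol [simp]: "space (Vol \<alpha>) = UNIV"
  by (simp add: Vol_def)

lemma Vol_density_measurable [measurable]:
  "(\<lambda>z. ennreal (indicator UHP z * Im z powr \<alpha>)) \<in> borel_measurable borel"
  by measurable

section \<open>Measures of boxes: scaling, null edges, finiteness and positivity\<close>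

lemma emeasure_Vol:
  assumes [measurable]: "S \<in> sets borel"
  shows "emeasure (Vol \<alpha>) S = (\<integral>\<^sup>+z. ennreal (indicator UHP z * Im z powr \<alpha>) * indicator S z \<partial>lborel)"
  unfolding Vol_def by (rule emeasure_density) auto

lemma sigma_finite_Vol: "sigma_finite_measure (Vol \<alpha>)"
  unfolding Vol_def by (subst sigma_finite_measure.sigma_finite_iff_density_finite[OF sigma_finite_lborel]) auto

text \<open>The measure is invariant under real translations and homogeneous of degree 2 + \<alpha>:
  2 comes from the area and \<alpha> from the density. This reduces all boxes to the unit
  box.\<close>

lemma emeasure_Vol_scale:
  assumes [measurable]: "S \<in> sets borel" "S' \<in> sets borel" and h: "0 < h"
    and S': "\<And>z. of_real a + of_real h * z \<in> S' \<longleftrightarrow> z \<in> S"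
  shows "emeasure (Vol \<alpha>) S' = ennreal (h powr (2 + \<alpha>)) * emeasure (Vol \<alpha>) S"
proof -
  let ?T = "\<lambda>z::complex. of_real a + h *\<^sub>R z"
  have T: "?T z \<in> S' \<longleftrightarrow> z \<in> S" for z
    using S'[of z] by (simp add: scaleR_conv_of_real)
  have "emeasure (Vol \<alpha>) S' = (\<integral>\<^sup>+z. ennreal (indicator UHP z * Im z powr \<alpha>) * indicator S' z
      \<partial>density (distr lborel borel ?T) (\<lambda>_. \<bar>h\<bar>^DIM(complex)))"
    using h by (subst lborel_affine[of h "of_real a", symmetric]) (auto simp: emeasure_Vol)
  also have "\<dots> = (\<integral>\<^sup>+z. ennreal (h\<^sup>2) * (ennreal (indicator UHP (?T z) * Im (?T z) powr \<alpha>) * indicator S' (?T z)) \<partial>lborel)"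
    by (simp add: nn_integral_density nn_integral_distr)
  also have "\<dots> = (\<integral>\<^sup>+z. ennreal (h powr (2 + \<alpha>)) * (ennreal (indicator UHP z * Im z powr \<alpha>) * indicator S z) \<partial>lborel)"
  proof (intro nn_integral_cong)
    fix z
    have e: "ennreal (h powr (2 + \<alpha>)) = ennreal (h\<^sup>2) * ennreal (h powr \<alpha>)"
      using h by (simp add: powr_add ennreal_mult)
    show "ennreal (h\<^sup>2) * (ennreal (indicator UHP (?T z) * Im (?T z) powr \<alpha>) * indicator S' (?T z)) =
       ennreal (h powr (2 + \<alpha>)) * (ennreal (indicator UHP z * Im z powr \<alpha>) * indicator S z)"
      using h unfolding e by (auto simp: indicator_def T UHP_def powr_mult ennreal_mult mult_ac zero_less_mult_iff)
  qed
  also have "\<dots> = ennreal (h powr (2 + \<alpha>)) * emeasure (Vol \<alpha>) S"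
    by (simp add: nn_integral_cmult emeasure_Vol)
  finally show ?thesis .
qed

lemma emeasure_lborel_rectangle:
  assumes "a \<le> b" "c \<le> d"
  shows "emeasure lborel {z::complex. a \<le> Re z \<and> Re z \<le> b \<and> c \<le> Im z \<and> Im z \<le> d} = ennreal ((b - a) * (d - c))"
proof -
  have "{z::complex. a \<le> Re z \<and> Re z \<le> b \<and> c \<le> Im z \<and> Im z \<le> d} = cbox (Complex a c) (Complex b d)"
    by (auto simp: in_cbox_complex_iff)
  then show ?thesis
    using assms by (simp add: emeasure_lborel_cbox_eq Basis_complex_def inner_complex_def)
qed

lemma AE_lborel_Re_neq: "AE z in lborel. Re z \<noteq> c"
proof -
  have "negligible {z::complex. z \<bullet> 1 = c}"
    by (rule negligible_standard_hyperplane) auto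
  then have "{z::complex. Re z = c} \<in> null_sets (completion lborel)"
    by (simp add: negligible_iff_null_sets inner_complex_def)
  then have "{z::complex. Re z = c} \<in> null_sets lborel"
    by (subst (asm) null_sets_completion_iff) auto
  then show ?thesis
    by (rule AE_not_in[THEN AE_mp]) auto
qed

lemma AE_Qbox_Dbox: "AE z in Vol \<alpha>. z \<in> Qbox a b \<longleftrightarrow> z \<in> Dbox a (b - a)"
proof -
  have "AE z in lborel. z \<in> Qbox a b \<longleftrightarrow> z \<in> Dbox a (b - a)"
    using AE_lborel_Re_neq[of b] by eventually_elim (auto simp: Qbox_def Dbox_def)
  then show ?thesis
    unfolding Vol_def by (subst AE_density) auto
qed

lemma set_nn_integral_Qbox:
  "(\<integral>\<^sup>+z\<in>Qbox a b. g z \<partial>Vol \<alpha>) = (\<integral>\<^sup>+z\<in>Dbox a (b - a). g z \<partial>Vol \<alpha>)"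
proof (rule nn_integral_cong_AE)
  show "AE z in Vol \<alpha>. g z * indicator (Qbox a b) z = g z * indicator (Dbox a (b - a)) z"
    using AE_Qbox_Dbox[of a b \<alpha>] by eventually_elim (auto simp: indicator_def)
qed

lemma emeasure_Qbox: "emeasure (Vol \<alpha>) (Qbox a b) = emeasure (Vol \<alpha>) (Dbox a (b - a))"
  using AE_Qbox_Dbox[of a b \<alpha>] by (intro emeasure_eq_AE) auto

text \<open>The box is cut into horizontal strips at heights comparable to 2^(-n). There the density
  is comparable to 2^(-n \<alpha>) and the area to 2^(-n), which gives a geometric series of ratio r
  = 2^(-(1 + \<alpha>)); \<alpha> > -1 says exactly that r < 1.\<close>

lemma emeasure_Dbox_unit_finite:
  assumes "-1 < \<alpha>"
  shows "emeasure (Vol \<alpha>) (Dbox 0 1) < top"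
proof -
  define S where "S n = {z. 0 \<le> Re z \<and> Re z \<le> 1 \<and> (1/2) ^ Suc n \<le> Im z \<and> Im z \<le> (1/2) ^ n}" for n
  define r where "r = 2 powr (-(1 + \<alpha>))"
  have r: "0 < r" "r < 1" using assms by (auto simp: r_def powr_less_one)
  have [measurable]: "S n \<in> sets borel" for n unfolding S_def by measurable
  have "Dbox 0 1 \<subseteq> (\<Union>n. S n)"
  proof
    fix z assume z: "z \<in> Dbox 0 1"
    then have "0 < Im z" by (simp add: Dbox_def)
    then obtain n0 where "(1/2) ^ n0 < Im z" using real_arch_pow_inv[of "Im z" "1/2"] by auto
    then have ex: "\<exists>n. (1/2) ^ n \<le> Im z" by (auto intro: less_imp_le)
    \<comment> \<open>The strip index is one less than this least n, which is positive because
      \<open>Im z\<close> < 1.\<close>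
    define n where "n = (LEAST n. (1/2) ^ n \<le> Im z)"
    have n: "(1/2) ^ n \<le> Im z" unfolding n_def using ex by (rule LeastI_ex)
    then have "n \<noteq> 0" using z by (cases "n = 0") (auto simp: Dbox_def)
    then obtain k where k: "n = Suc k" by (cases n) auto
    then have "\<not> (1/2) ^ k \<le> Im z" using not_less_Least[of k "\<lambda>n. (1/2) ^ n \<le> Im z"] by (simp add: n_def)
    then show "z \<in> (\<Union>n. S n)" using n z k by (auto simp: S_def Dbox_def intro!: exI[of _ k])
  qed
  then have "emeasure (Vol \<alpha>) (Dbox 0 1) \<le> emeasure (Vol \<alpha>) (\<Union>n. S n)"
    by (intro emeasure_mono) auto
  also have "\<dots> \<le> (\<Sum>n. emeasure (Vol \<alpha>) (S n))"
    by (intro emeasure_subadditive_countably) auto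
  also have "\<dots> \<le> (\<Sum>n. ennreal (2 powr \<bar>\<alpha>\<bar> * r ^ n))"
  proof (intro suminf_le)
    fix n
    have "emeasure (Vol \<alpha>) (S n) \<le> (\<integral>\<^sup>+z. ennreal (2 powr \<bar>\<alpha>\<bar> * 2 powr (- real n * \<alpha>)) * indicator (S n) z \<partial>lborel)"
      unfolding emeasure_Vol[OF \<open>S n \<in> sets borel\<close>]
    proof (intro nn_integral_mono)
      fix z show "ennreal (indicator UHP z * Im z powr \<alpha>) * indicator (S n) z
          \<le> ennreal (2 powr \<bar>\<alpha>\<bar> * 2 powr (- real n * \<alpha>)) * indicator (S n) z"
      proof (cases "z \<in> S n")
        case True
        have e: "(1/2) ^ n = 2 powr (- real n)" "(1/2) ^ Suc n = 2 powr (- real n - 1)"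
          by (simp_all add: powr_minus powr_realpow power_one_over powr_diff inverse_eq_divide)
        from True have z: "2 powr (- real n - 1) \<le> Im z" "Im z \<le> 2 powr (- real n)"
          unfolding S_def e by auto
        then have "0 < Im z" using powr_gt_zero[of 2 "- real n - 1"] by linarith
        \<comment> \<open>The density is largest on the upper edge of the strip if \<alpha> \<ge> 0
          and on the lower edge otherwise; the factor \<open>2 powr \<bar>\<alpha>\<bar>\<close>
          covers both cases.\<close>
        have "Im z powr \<alpha> \<le> 2 powr \<bar>\<alpha>\<bar> * 2 powr (- real n * \<alpha>)"
        proof (cases "0 \<le> \<alpha>")
          case True
          then have "Im z powr \<alpha> \<le> (2 powr (- real n)) powr \<alpha>"
            using z \<open>0 < Im z\<close> by (intro powr_mono2) auto
          also have "\<dots> = 1 * 2 powr (- real n * \<alpha>)" by (simp add: powr_powr)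
          also have "\<dots> \<le> 2 powr \<bar>\<alpha>\<bar> * 2 powr (- real n * \<alpha>)"
            by (intro mult_right_mono) (auto simp: ge_one_powr_ge_zero)
          finally show ?thesis .
        next
          case False
          then have "Im z powr \<alpha> \<le> (2 powr (- real n - 1)) powr \<alpha>"
            using z \<open>0 < Im z\<close> by (intro powr_mono2') auto
          also have "\<dots> = 2 powr \<bar>\<alpha>\<bar> * 2 powr (- real n * \<alpha>)"
          proof -
            have "(- real n - 1) * \<alpha> = \<bar>\<alpha>\<bar> + - real n * \<alpha>"
              using False by (simp add: algebra_simps)
            then show ?thesis by (simp only: powr_powr powr_add)
          qed
          finally show ?thesis .
        qed
        then show ?thesis using True by (auto simp: indicator_def intro!: ennreal_leI)
      qed simp
    qed
    also have "\<dots> = ennreal (2 powr \<bar>\<alpha>\<bar> * 2 powr (- real n * \<alpha>)) * emeasure lborel (S n)"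
      by (intro nn_integral_cmult_indicator) auto
    also have "emeasure lborel (S n) = ennreal ((1 - 0) * ((1/2) ^ n - (1/2) ^ Suc n))"
      unfolding S_def by (rule emeasure_lborel_rectangle) auto
    also have "ennreal (2 powr \<bar>\<alpha>\<bar> * 2 powr (- real n * \<alpha>)) * \<dots> =
       ennreal (2 powr \<bar>\<alpha>\<bar> * 2 powr (- real n * \<alpha>) * ((1/2) ^ n / 2))"
      by (subst ennreal_mult[symmetric]) auto
    also have "\<dots> \<le> ennreal (2 powr \<bar>\<alpha>\<bar> * r ^ n)"
    proof (intro ennreal_leI)
      have "r ^ n = r powr real n" using r by (simp add: powr_realpow)
      also have "\<dots> = 2 powr (- real n * \<alpha> + - real n)" by (simp add: r_def powr_powr algebra_simps)
      also have "\<dots> = 2 powr (- real n * \<alpha>) * (1/2) ^ n"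
        by (simp only: powr_add) (simp add: powr_minus powr_realpow power_one_over inverse_eq_divide)
      finally have "r ^ n = 2 powr (- real n * \<alpha>) * (1/2) ^ n" .
      then show "2 powr \<bar>\<alpha>\<bar> * 2 powr (- real n * \<alpha>) * ((1/2) ^ n / 2) \<le> 2 powr \<bar>\<alpha>\<bar> * r ^ n"
        by simp
    qed
    finally show "emeasure (Vol \<alpha>) (S n) \<le> ennreal (2 powr \<bar>\<alpha>\<bar> * r ^ n)" .
  qed auto
  also have "\<dots> < top"
    using r by (subst suminf_ennreal2) (auto intro!: summable_mult summable_geometric)
  finally show ?thesis .
qed

lemma emeasure_Tbox_unit_pos: "0 < emeasure (Vol \<alpha>) (Tbox 0 1)"
proof -
  define S where "S = {z. 0 \<le> Re z \<and> Re z \<le> 1/2 \<and> 1/2 \<le> Im z \<and> Im z \<le> 3/4}"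
  have [measurable]: "S \<in> sets borel" unfolding S_def by measurable
  have "0 < ennreal (2 powr - \<bar>\<alpha>\<bar>) * emeasure lborel S"
    unfolding S_def by (subst emeasure_lborel_rectangle) (auto simp: ennreal_zero_less_mult_iff)
  also have "\<dots> = (\<integral>\<^sup>+z. ennreal (2 powr - \<bar>\<alpha>\<bar>) * indicator S z \<partial>lborel)"
    by (intro nn_integral_cmult_indicator[symmetric]) auto
  also have "\<dots> \<le> emeasure (Vol \<alpha>) S"
    unfolding emeasure_Vol[OF \<open>S \<in> sets borel\<close>]
  proof (intro nn_integral_mono)
    fix z show "ennreal (2 powr - \<bar>\<alpha>\<bar>) * indicator S z \<le> ennreal (indicator UHP z * Im z powr \<alpha>) * indicator S z"
    proof (cases "z \<in> S")
      case True
      then have z: "1/2 \<le> Im z" "Im z \<le> 1" by (auto simp: S_def)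
      have "2 powr - \<bar>\<alpha>\<bar> = (1/2) powr \<bar>\<alpha>\<bar>" by (simp add: powr_minus_divide powr_divide)
      also have "\<dots> \<le> Im z powr \<bar>\<alpha>\<bar>" using z by (intro powr_mono2) auto
      \<comment> \<open>The base is at most 1, so lowering the exponent to \<alpha> increases the
        power, whatever the sign of \<alpha>.\<close>
      also have "\<dots> \<le> Im z powr \<alpha>" using z by (intro powr_mono') auto
      finally show ?thesis using True z by (auto simp: UHP_def indicator_def intro!: ennreal_leI)
    qed simp
  qed
  also have "\<dots> \<le> emeasure (Vol \<alpha>) (Tbox 0 1)"
    by (intro emeasure_mono) (auto simp: S_def Tbox_def)
  finally show ?thesis .
qed

text \<open>For \<alpha> > -1 this is 1 / (1 + \<alpha>), and \<open>t0 \<alpha>\<close> is (1 -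
  2^(-(1 + \<alpha>))) / (1 + \<alpha>). Positivity and finiteness are all that the estimates ask of
  them, so the integrals are not evaluated.\<close>

definition v0 :: "real \<Rightarrow> real" where "v0 \<alpha> = measure (Vol \<alpha>) (Dbox 0 1)"

definition t0 :: "real \<Rightarrow> real" where "t0 \<alpha> = measure (Vol \<alpha>) (Tbox 0 1)"

context
  fixes \<alpha> :: real
  assumes \<alpha>: "-1 < \<alpha>"
begin

lemma emeasure_Dbox:
  assumes "0 < h"
  shows "emeasure (Vol \<alpha>) (Dbox a h) = ennreal (v0 \<alpha> * h powr (2 + \<alpha>))"
proof -
  have "emeasure (Vol \<alpha>) (Dbox a h) = ennreal (h powr (2 + \<alpha>)) * emeasure (Vol \<alpha>) (Dbox 0 1)"
    using assms by (intro emeasure_Vol_scale[where a = a]) (auto simp: Dbox_def zero_less_mult_iff zero_le_mult_iff)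
  also have "emeasure (Vol \<alpha>) (Dbox 0 1) = ennreal (v0 \<alpha>)"
    using emeasure_Dbox_unit_finite[OF \<alpha>] by (simp add: v0_def emeasure_eq_ennreal_measure)
  finally show ?thesis by (simp add: ennreal_mult mult.commute v0_def)
qed

lemma emeasure_Tbox:
  assumes "0 < h"
  shows "emeasure (Vol \<alpha>) (Tbox a h) = ennreal (t0 \<alpha> * h powr (2 + \<alpha>))"
proof -
  have scale: "emeasure (Vol \<alpha>) (Tbox a h) = ennreal (h powr (2 + \<alpha>)) * emeasure (Vol \<alpha>) (Tbox 0 1)"
    using assms by (intro emeasure_Vol_scale[where a = a]) (auto simp: Tbox_def zero_le_mult_iff field_simps)
  have "emeasure (Vol \<alpha>) (Tbox 0 1) \<le> emeasure (Vol \<alpha>) (Dbox 0 1)"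
    by (intro emeasure_mono) (auto simp: Tbox_def Dbox_def)
  also note emeasure_Dbox_unit_finite[OF \<alpha>]
  finally have "emeasure (Vol \<alpha>) (Tbox 0 1) = ennreal (t0 \<alpha>)"
    by (simp add: t0_def emeasure_eq_ennreal_measure)
  then show ?thesis by (simp add: scale ennreal_mult mult.commute t0_def)
qed

lemma t0_pos: "0 < t0 \<alpha>"
  using emeasure_Tbox_unit_pos[of \<alpha>] emeasure_Tbox[of 1 0] by simp

lemma v0_pos: "0 < v0 \<alpha>"
proof -
  have "emeasure (Vol \<alpha>) (Tbox 0 1) \<le> emeasure (Vol \<alpha>) (Dbox 0 1)"
    by (intro emeasure_mono) (auto simp: Tbox_def Dbox_def)
  with emeasure_Tbox_unit_pos[of \<alpha>] emeasure_Dbox[of 1 0] show ?thesis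
    by (metis ennreal_less_zero_iff mult.right_neutral not_less order_less_le_trans powr_one_eq_one zero_less_one)
qed

lemma volA_Qbox: "a < b \<Longrightarrow> volA \<alpha> (Qbox a b) = v0 \<alpha> * (b - a) powr (2 + \<alpha>)"
  using v0_pos by (simp add: volA_def emeasure_Qbox emeasure_Dbox)

end

section \<open>Dyadic grids\<close>

text \<open>In (e, k, m), e selects the standard or the shifted grid, k is the scale and m the
  position.\<close>

type_synonym grid_index = "bool \<times> int \<times> int"

definition side :: "grid_index \<Rightarrow> real" where
  "side = (\<lambda>(e, k, m). 2 powr of_int k)"

text \<open>The one-third trick. The sign alternates with the scale because 2^(k+1)/3 + 2^k/3 is the
  integer multiple 2^k of the mesh, while the difference 2^k/3 is not; without this the shifted grid
  would not be nested.\<close>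

definition shift :: "bool \<Rightarrow> int \<Rightarrow> real" where
  "shift e k = (if e then (if even k then 1 else - 1) * 2 powr of_int k / 3 else 0)"

definition left :: "grid_index \<Rightarrow> real" where
  "left = (\<lambda>(e, k, m). shift e k + of_int m * 2 powr of_int k)"

definition cell :: "grid_index \<Rightarrow> complex set" where
  "cell i = Dbox (left i) (side i)"

definition top_half :: "grid_index \<Rightarrow> complex set" where
  "top_half i = Tbox (left i) (side i)"

text \<open>Turns geometry into arithmetic: two points lie over the same cell of scale k exactly if
  their numbers agree, and nesting says that the number at a coarser scale is a function of the
  finer one.\<close>

definition cell_no :: "bool \<Rightarrow> int \<Rightarrow> real \<Rightarrow> int" where
  "cell_no e k x = \<lfloor>(x - shift e k) / 2 powr of_int k\<rfloor>"

lemma side_pos [simp]: "0 < side i"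
  by (simp add: side_def split: prod.split)

lemma measurable_cell [measurable]: "cell i \<in> sets borel"
  by (simp add: cell_def)

lemma measurable_top_half [measurable]: "top_half i \<in> sets borel"
  by (simp add: top_half_def)

lemma top_half_subset: "top_half i \<subseteq> cell i"
  using side_pos[of i] by (auto simp: top_half_def cell_def Tbox_def Dbox_def)

section \<open>Nesting and disjointness within one grid\<close>

lemma cell_no_iff:
  "cell_no e k x = m \<longleftrightarrow> left (e, k, m) \<le> x \<and> x < left (e, k, m) + 2 powr of_int k"
  unfolding cell_no_def floor_eq_iff by (simp add: left_def field_simps)

lemma mem_cell_iff:
  "z \<in> cell (e, k, m) \<longleftrightarrow> cell_no e k (Re z) = m \<and> 0 < Im z \<and> Im z < 2 powr of_int k"
  by (auto simp: cell_no_iff cell_def Dbox_def side_def)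

lemma mem_top_half_iff:
  "z \<in> top_half (e, k, m) \<longleftrightarrow> cell_no e k (Re z) = m \<and> 2 powr (of_int k - 1) \<le> Im z \<and> Im z < 2 powr of_int k"
  by (auto simp: cell_no_iff top_half_def Tbox_def side_def powr_diff)

lemma shift_step: "\<exists>n::int. shift e (k + 1) = shift e k + of_int n * 2 powr of_int k"
proof -
  have "shift e (k + 1) = shift e k + of_int (if e then if even k then - 1 else 1 else 0) * 2 powr of_int k"
    by (auto simp: shift_def powr_add)
  then show ?thesis ..
qed

text \<open>Since the two shifts differ by a multiple of 2^k, the coarser number is the finer one,
  translated and divided by 2 with \<open>div\<close>.\<close>

lemma cell_no_step:
  assumes "cell_no e k x = cell_no e k y"
  shows "cell_no e (k + 1) x = cell_no e (k + 1) y"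
proof -
  obtain n where n: "shift e (k + 1) = shift e k + of_int n * 2 powr of_int k"
    using shift_step by blast
  have "cell_no e (k + 1) x = (cell_no e k x - n) div 2" for x
  proof -
    have "(x - shift e (k + 1)) / 2 powr of_int (k + 1) = ((x - shift e k) / 2 powr of_int k - of_int n) / of_int 2"
      unfolding n by (simp add: powr_add field_simps)
    then have "cell_no e (k + 1) x = \<lfloor>(x - shift e k) / 2 powr of_int k - of_int n\<rfloor> div 2"
      unfolding cell_no_def by (simp only: floor_divide_real_eq_div)
    then show ?thesis by (simp add: cell_no_def)
  qed
  with assms show ?thesis by simp
qed

lemma cell_no_coarser:
  assumes "j \<le> k" "cell_no e j x = cell_no e j y"
  shows "cell_no e k x = cell_no e k y"
  using assms(1) by (induction k rule: int_ge_induct) (auto intro: cell_no_step assms(2))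

text \<open>If two cells share a point, every point of the finer one has the same number as that
  point at the coarser scale.\<close>

lemma cell_laminar:
  "cell (e, j, m) \<subseteq> cell (e, k, n) \<or> cell (e, k, n) \<subseteq> cell (e, j, m) \<or> cell (e, j, m) \<inter> cell (e, k, n) = {}"
proof -
  have *: "cell (e, j, m) \<subseteq> cell (e, k, n)"
    if "j \<le> k" "cell (e, j, m) \<inter> cell (e, k, n) \<noteq> {}" for j k m n
  proof
    fix z assume z: "z \<in> cell (e, j, m)"
    from that obtain w where w: "w \<in> cell (e, j, m)" "w \<in> cell (e, k, n)" by auto
    have "cell_no e j (Re z) = cell_no e j (Re w)"
      using z w(1) by (simp add: mem_cell_iff)
    then have "cell_no e k (Re z) = cell_no e k (Re w)"
      by (rule cell_no_coarser[OF that(1)])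
    moreover have "Im z < 2 powr of_int k"
    proof -
      have "Im z < 2 powr of_int j" using z by (simp add: mem_cell_iff)
      also have "\<dots> \<le> 2 powr of_int k" using that(1) by simp
      finally show ?thesis .
    qed
    ultimately show "z \<in> cell (e, k, n)"
      using z w(2) by (simp add: mem_cell_iff)
  qed
  show ?thesis using *[of j k m n] *[of k j n m] by (cases "j \<le> k") auto
qed

lemma top_half_disjoint:
  assumes "z \<in> top_half (e, j, m)" "z \<in> top_half (e, k, n)"
  shows "j = k \<and> m = n"
proof -
  have "j \<le> k" if "z \<in> top_half (e, j, m)" "z \<in> top_half (e, k, n)" for j k m n
  proof -
    have "2 powr (of_int j - 1) \<le> Im z" "Im z < 2 powr of_int k"
      using that by (simp_all add: mem_top_half_iff)
    then have "2 powr (of_int j - 1) < (2 powr of_int k :: real)" by (rule order_le_less_trans)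
    then show ?thesis by simp
  qed
  from this[OF assms] this[OF assms(2,1)] assms show ?thesis by (auto simp: mem_top_half_iff)
qed

lemma top_half_nonempty: "\<exists>z. z \<in> top_half i"
proof -
  have "Complex (left i) (side i / 2) \<in> top_half i"
    by (simp add: top_half_def Tbox_def)
  then show ?thesis by blast
qed

text \<open>The top half of a larger cell lies above every smaller cell, so the scale can be read
  off. Injectivity is needed because the embedding theorem sums over sets and the maximal function
  over indices.\<close>

lemma cell_inject:
  assumes "cell (e, j, m) = cell (e, k, n)"
  shows "j = k \<and> m = n"
proof -
  have le: "k \<le> j" if "cell (e, j, m) = cell (e, k, n)" for j k m n
  proof (rule ccontr)
    assume "\<not> k \<le> j"
    then have "2 powr of_int j \<le> (2 powr (of_int k - 1) :: real)" by (intro powr_mono) auto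
    moreover obtain z where z: "z \<in> top_half (e, k, n)" using top_half_nonempty by blast
    moreover have "z \<in> cell (e, j, m)" using z top_half_subset that by blast
    ultimately show False unfolding mem_top_half_iff mem_cell_iff by linarith
  qed
  obtain z where "z \<in> cell (e, j, m)" using top_half_nonempty top_half_subset by blast
  with assms le[OF assms] le[OF assms[symmetric]] show ?thesis by (auto simp: mem_cell_iff)
qed

text \<open>The endpoints of the two grids at one scale are at least a third of a side apart, so a short
  interval cannot straddle endpoints of both.\<close>
lemma Qbox_subset_cell:
  assumes "a < b"
  shows "\<exists>i. Qbox a b \<subseteq> cell i \<and> side i \<le> 6 * (b - a)"
proof -
  \<comment> \<open>The scale for which 3 (b - a) < 2^k \<le> 6 (b - a): a cell is longer than three
    times the interval, and the rounding to a power of 2 doubles this to the factor 6.\<close>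
  define k where "k = \<lfloor>log 2 (3 * (b - a))\<rfloor> + 1"
  define h where "h = (2::real) powr of_int k"
  have "0 < h" by (simp add: h_def)
  have log: "3 * (b - a) = 2 powr log 2 (3 * (b - a))" using assms by simp
  have "3 * (b - a) < h"
    unfolding h_def by (subst log, rule powr_less_mono) (auto simp: k_def)
  moreover have "2 powr (of_int k - 1) \<le> 3 * (b - a)"
    by (subst log, rule powr_mono) (auto simp: k_def)
  ultimately have h: "3 * (b - a) < h" "h \<le> 6 * (b - a)" by (simp_all add: h_def powr_diff)
  have found: ?thesis if "left (e, k, m) \<le> a" "b < left (e, k, m) + h" for e m
  proof (intro exI conjI)
    show "Qbox a b \<subseteq> cell (e, k, m)"
      using that h assms by (auto simp: Qbox_def cell_def Dbox_def side_def h_def)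
    show "side (e, k, m) \<le> 6 * (b - a)" using h by (simp add: side_def h_def)
  qed
  define m where "m = \<lfloor>a / h\<rfloor>"
  have m: "of_int m * h \<le> a" "a < of_int m * h + h"
  proof -
    have "of_int m \<le> a / h" "a / h < of_int m + 1" unfolding m_def by linarith+
    then show "of_int m * h \<le> a" "a < of_int m * h + h"
      using \<open>0 < h\<close> by (simp_all add: pos_le_divide_eq pos_divide_less_eq distrib_right)
  qed
  show ?thesis
  proof (cases "b < of_int m * h + h")
    case True
    with m show ?thesis by (intro found[of False m]) (simp_all add: left_def shift_def h_def)
  next
    case False
    \<comment> \<open>The standard endpoint \<open>of_int m * h + h\<close> lies in (a, b], so the
      interval stays within h / 3 of it. The shifted cell around that endpoint has number m if the
      shift is h / 3 and m + 1 if it is -h / 3.\<close>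
    show ?thesis
    proof (cases "even k")
      case True
      with m h False show ?thesis
        by (intro found[of True m]) (simp_all add: left_def shift_def h_def[symmetric])
    next
      case odd: False
      with m h False show ?thesis
        by (intro found[of True "m + 1"]) (simp_all add: left_def shift_def h_def[symmetric] algebra_simps)
    qed
  qed
qed

section \<open>The two-weight estimate\<close>

text \<open>Lets a sum over all cells be estimated through the finite families of the embedding
  theorem.\<close>

lemma nn_integral_count_space_le:
  fixes h :: "'i::countable \<Rightarrow> ennreal"
  assumes "\<And>G. finite G \<Longrightarrow> sum h G \<le> B"
  shows "(\<integral>\<^sup>+i. h i \<partial>count_space UNIV) \<le> B"
proof -
  \<comment> \<open>On this range \<open>from_nat\<close> is injective, so no index is counted
    twice.\<close>
  let ?R = "range (to_nat :: 'i \<Rightarrow> nat)"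
  have "(\<integral>\<^sup>+i. h i \<partial>count_space UNIV) = (\<integral>\<^sup>+i. h (from_nat (to_nat (i :: 'i))) \<partial>count_space UNIV)"
    by simp
  also have "\<dots> = (\<integral>\<^sup>+n. h (from_nat n) \<partial>count_space ?R)"
    by (rule nn_integral_bij_count_space) (rule inj_on_imp_bij_betw, rule inj_to_nat)
  also have "\<dots> = (\<integral>\<^sup>+n. h (from_nat n) * indicator ?R n \<partial>count_space UNIV)"
    by (rule nn_integral_count_space_indicator) simp
  also have "\<dots> = (\<Sum>n. h (from_nat n) * indicator ?R n)"
    by (rule nn_integral_count_space_nat)
  also have "\<dots> \<le> B"
  proof (rule suminf_le_const)
    fix n
    have "(\<Sum>k<n. h (from_nat k) * indicator ?R k) = (\<Sum>k\<in>{..<n} \<inter> ?R. h (from_nat k))"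
      by (simp add: indicator_def sum.inter_restrict if_distrib cong: if_cong)
    also have "\<dots> = sum h (from_nat ` ({..<n} \<inter> ?R))"
      by (rule sum.reindex_cong[symmetric, where l = from_nat]) (auto intro!: inj_onI)
    also have "\<dots> \<le> B" by (rule assms) auto
    finally show "(\<Sum>k<n. h (from_nat k) * indicator ?R k) \<le> B" .
  qed simp
  finally show ?thesis .
qed

text \<open>Enlarging a box to a cell at most 6 times as long costs 6 to the power 2 + \<alpha> -
  \<gamma>, and one term of a nonnegative series is at most its sum. The q-th root of the series
  thus bounds every average at once.\<close>

lemma maxfun_le_sum:
  assumes "0 \<le> 2 + \<alpha> - \<gamma>" "0 < q"
  shows "epowr (maxfun \<alpha> \<gamma> g z) q \<le> ennreal (6 powr ((2 + \<alpha> - \<gamma>) * q)) *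
    (\<integral>\<^sup>+i. epowr (ennreal (side i powr - (2 + \<alpha> - \<gamma>)) * (\<integral>\<^sup>+w\<in>cell i. g w \<partial>Vol \<alpha>)) q
       * indicator (cell i) z \<partial>count_space UNIV)" (is "_ \<le> _ * ?B")
proof -
  let ?d = "2 + \<alpha> - \<gamma>"
  define X where "X i = ennreal (side i powr - ?d) * (\<integral>\<^sup>+w\<in>cell i. g w \<partial>Vol \<alpha>)" for i
  have scale: "(x / 6) powr - d = 6 powr d * x powr - d" if "0 < x" for x d :: real
    using that by (simp add: powr_divide powr_minus_divide)
  have "maxfun \<alpha> \<gamma> g z \<le> ennreal (6 powr ?d) * epowr ?B (1 / q)"
    unfolding maxfun_def
  proof (rule SUP_least)
    fix ab assume "ab \<in> {(a, b). a < b \<and> z \<in> Qbox a b}"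
    then obtain a b where ab: "ab = (a, b)" "a < b" "z \<in> Qbox a b" by auto
    obtain i where i: "Qbox a b \<subseteq> cell i" "side i \<le> 6 * (b - a)"
      using Qbox_subset_cell[OF ab(2)] by blast
    have "(b - a) powr - ?d \<le> (side i / 6) powr - ?d"
      using assms i ab side_pos[of i] by (intro powr_mono2') auto
    also have "\<dots> = 6 powr ?d * side i powr - ?d"
      using scale side_pos by blast
    finally have "ennreal ((b - a) powr - ?d) * (\<integral>\<^sup>+w\<in>Qbox a b. g w \<partial>Vol \<alpha>)
        \<le> ennreal (6 powr ?d * side i powr - ?d) * (\<integral>\<^sup>+w\<in>cell i. g w \<partial>Vol \<alpha>)"
      using i by (intro mult_mono ennreal_leI nn_integral_mono) (auto split: split_indicator)
    also have "\<dots> = ennreal (6 powr ?d) * X i"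
      by (simp add: X_def ennreal_mult mult.assoc)
    also have "X i = epowr (epowr (X i) q * indicator (cell i) z) (1 / q)"
      using i ab assms by (auto simp: indicator_def)
    also have "\<dots> \<le> epowr ?B (1 / q)"
      unfolding X_def using assms by (intro epowr_mono nn_integral_ge_point) auto
    finally show "ennreal ((snd ab - fst ab) powr - ?d) * (\<integral>\<^sup>+w\<in>Qbox (fst ab) (snd ab). g w \<partial>Vol \<alpha>)
        \<le> ennreal (6 powr ?d) * epowr ?B (1 / q)"
      by (simp add: ab mult_left_mono)
  qed
  then have "epowr (maxfun \<alpha> \<gamma> g z) q \<le> epowr (ennreal (6 powr ?d) * epowr ?B (1 / q)) q"
    using assms by (intro epowr_mono) auto
  also have "\<dots> = ennreal (6 powr (?d * q)) * ?B"
    using assms by (simp add: epowr_mult powr_powr)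
  finally show ?thesis .
qed

lemma nn_integral_maxfun_le_sum:
  assumes "0 \<le> 2 + \<alpha> - \<gamma>" "0 < q" and [measurable]: "\<omega> \<in> borel_measurable borel"
  shows "(\<integral>\<^sup>+z. epowr (maxfun \<alpha> \<gamma> g z) q * \<omega> z \<partial>Vol \<alpha>) \<le> ennreal (6 powr ((2 + \<alpha> - \<gamma>) * q)) *
    (\<integral>\<^sup>+i. epowr (ennreal (side i powr - (2 + \<alpha> - \<gamma>)) * (\<integral>\<^sup>+w\<in>cell i. g w \<partial>Vol \<alpha>)) q
       * wmeas \<alpha> \<omega> (cell i) \<partial>count_space UNIV)"
proof -
  define X where "X i = epowr (ennreal (side i powr - (2 + \<alpha> - \<gamma>)) * (\<integral>\<^sup>+w\<in>cell i. g w \<partial>Vol \<alpha>)) q" for i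
  let ?c = "ennreal (6 powr ((2 + \<alpha> - \<gamma>) * q))"
  have "(\<integral>\<^sup>+z. epowr (maxfun \<alpha> \<gamma> g z) q * \<omega> z \<partial>Vol \<alpha>)
      \<le> (\<integral>\<^sup>+z. (\<integral>\<^sup>+i. ?c * X i * (\<omega> z * indicator (cell i) z) \<partial>count_space UNIV) \<partial>Vol \<alpha>)"
  proof (intro nn_integral_mono)
    fix z
    have "epowr (maxfun \<alpha> \<gamma> g z) q * \<omega> z \<le> ?c * (\<integral>\<^sup>+i. X i * indicator (cell i) z \<partial>count_space UNIV) * \<omega> z"
      using maxfun_le_sum[OF assms(1,2), of g z] unfolding X_def by (rule mult_right_mono) simp
    also have "\<dots> = (?c * \<omega> z) * (\<integral>\<^sup>+i. X i * indicator (cell i) z \<partial>count_space UNIV)"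
      by (simp only: mult_ac)
    also have "\<dots> = (\<integral>\<^sup>+i. ?c * \<omega> z * (X i * indicator (cell i) z) \<partial>count_space UNIV)"
      by (rule nn_integral_cmult[symmetric]) simp
    finally show "epowr (maxfun \<alpha> \<gamma> g z) q * \<omega> z \<le> (\<integral>\<^sup>+i. ?c * X i * (\<omega> z * indicator (cell i) z) \<partial>count_space UNIV)"
      by (simp add: mult_ac)
  qed
  also have "\<dots> = (\<integral>\<^sup>+i. (\<integral>\<^sup>+z. ?c * X i * (\<omega> z * indicator (cell i) z) \<partial>Vol \<alpha>) \<partial>count_space UNIV)"
    by (rule nn_integral_count_space_nn_integral) auto
  also have "\<dots> = (\<integral>\<^sup>+i. ?c * (X i * wmeas \<alpha> \<omega> (cell i)) \<partial>count_space UNIV)"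
    by (simp add: nn_integral_cmult wmeas_def mult.assoc)
  also have "\<dots> = ?c * (\<integral>\<^sup>+i. X i * wmeas \<alpha> \<omega> (cell i) \<partial>count_space UNIV)"
    by (rule nn_integral_cmult) simp
  finally show ?thesis by (simp add: X_def)
qed

text \<open>The embedding theorem reindexed by cells. All indices belong to one grid, since cells of
  different grids may overlap without being nested.\<close>

lemma carleson_embedding_cells:
  assumes [measurable]: "v \<in> borel_measurable borel" "f \<in> borel_measurable borel"
    and "finite G" and e: "\<And>i. i \<in> G \<Longrightarrow> fst i = e"
    and fin: "\<And>i. i \<in> G \<Longrightarrow> wmeas \<alpha> v (cell i) < top"
    and carleson: "\<And>i. i \<in> G \<Longrightarrow> (\<Sum>j | j \<in> G \<and> cell j \<subseteq> cell i. a j) \<le> K * wmeas \<alpha> v (cell i)"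
    and "1 < p"
  shows "(\<Sum>i\<in>G. a i * epowr (wmeas \<alpha> (\<lambda>z. f z * v z) (cell i) / wmeas \<alpha> v (cell i)) p)
    \<le> ennreal (2 powr p * p / (p - 1)) * K * (\<integral>\<^sup>+z. epowr (f z) p * v z \<partial>Vol \<alpha>)"
proof -
  have inj: "inj_on cell G"
  proof (rule inj_onI)
    fix i j assume "i \<in> G" "j \<in> G" "cell i = cell j"
    then show "i = j" using e[of i] e[of j] by (cases i; cases j) (auto dest!: cell_inject)
  qed
  \<comment> \<open>Coefficients belong to indices here and to sets in
    \<open>carleson_embedding\<close>; injectivity of \<open>cell\<close> makes the transfer well
    defined.\<close>
  define b where "b A = a (the_inv_into G cell A)" for A
  have b: "b (cell i) = a i" if "i \<in> G" for i
    using inj that by (simp add: b_def the_inv_into_f_f)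
  have "(\<Sum>A\<in>cell ` G. b A * epowr ((\<integral>\<^sup>+z\<in>A. f z * v z \<partial>Vol \<alpha>) / (\<integral>\<^sup>+z\<in>A. v z \<partial>Vol \<alpha>)) p)
    \<le> ennreal (2 powr p * p / (p - 1)) * K * (\<integral>\<^sup>+z. epowr (f z) p * v z \<partial>Vol \<alpha>)"
  proof (rule carleson_embedding)
    fix A B assume "A \<in> cell ` G" "B \<in> cell ` G"
    then obtain i i' where "A = cell i" "B = cell i'" "fst i = e" "fst i' = e"
      using e by blast
    then obtain j m k n where "A = cell (e, j, m)" "B = cell (e, k, n)"
      by (cases i; cases i') auto
    then show "A \<subseteq> B \<or> B \<subseteq> A \<or> A \<inter> B = {}" using cell_laminar by blast
  next
    fix A assume "A \<in> cell ` G"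
    then obtain i where i: "i \<in> G" "A = cell i" by blast
    show "(\<integral>\<^sup>+z\<in>A. v z \<partial>Vol \<alpha>) < top" using fin[OF i(1)] by (simp add: i wmeas_def)
    have "{B. B \<in> cell ` G \<and> B \<subseteq> A} = cell ` {j. j \<in> G \<and> cell j \<subseteq> cell i}" by (auto simp: i)
    then have "(\<Sum>B | B \<in> cell ` G \<and> B \<subseteq> A. b B) = (\<Sum>j | j \<in> G \<and> cell j \<subseteq> cell i. a j)"
      using inj b by (simp add: sum.reindex inj_on_def)
    then show "(\<Sum>B | B \<in> cell ` G \<and> B \<subseteq> A. b B) \<le> K * (\<integral>\<^sup>+z\<in>A. v z \<partial>Vol \<alpha>)"
      using carleson[OF i(1)] by (simp add: i wmeas_def)
  qed (use \<open>finite G\<close> \<open>1 < p\<close> in \<open>auto simp: sigma_finite_Vol\<close>)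
  then show ?thesis
    using inj b by (simp add: sum.reindex wmeas_def)
qed

text \<open>The upper halves of the cells of one grid are disjoint and fill a fixed proportion of the
  cells, so every grid is sparse and no stopping-time selection is needed.\<close>
lemma top_half_packing:
  assumes \<alpha>: "-1 < \<alpha>" and "finite G" and e: "\<And>j. j \<in> G \<Longrightarrow> fst j = e"
    and S: "\<And>j. j \<in> G \<Longrightarrow> cell j \<subseteq> S"
    and h: "\<And>j z. j \<in> G \<Longrightarrow> z \<in> cell j \<Longrightarrow> c j \<le> h z"
  shows "(\<Sum>j\<in>G. c j * ennreal (side j powr (2 + \<alpha>))) \<le> ennreal (1 / t0 \<alpha>) * (\<integral>\<^sup>+z\<in>S. h z \<partial>Vol \<alpha>)"
proof -
  note t0 = t0_pos[OF \<alpha>]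
  have "(\<Sum>j\<in>G. c j * ennreal (side j powr (2 + \<alpha>))) = (\<Sum>j\<in>G. ennreal (1 / t0 \<alpha>) * (c j * emeasure (Vol \<alpha>) (top_half j)))"
  proof (intro sum.cong refl)
    fix j
    have "ennreal (1 / t0 \<alpha>) * ennreal (t0 \<alpha> * side j powr (2 + \<alpha>)) = ennreal (side j powr (2 + \<alpha>))"
      using t0 by (subst ennreal_mult[symmetric]) auto
    then show "c j * ennreal (side j powr (2 + \<alpha>)) = ennreal (1 / t0 \<alpha>) * (c j * emeasure (Vol \<alpha>) (top_half j))"
      by (simp add: top_half_def emeasure_Tbox[OF \<alpha>] mult.left_commute)
  qed
  also have "\<dots> = ennreal (1 / t0 \<alpha>) * (\<Sum>j\<in>G. \<integral>\<^sup>+z. c j * indicator (top_half j) z \<partial>Vol \<alpha>)"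
    by (simp add: sum_distrib_left nn_integral_cmult_indicator)
  also have "(\<Sum>j\<in>G. \<integral>\<^sup>+z. c j * indicator (top_half j) z \<partial>Vol \<alpha>) = (\<integral>\<^sup>+z. (\<Sum>j\<in>G. c j * indicator (top_half j) z) \<partial>Vol \<alpha>)"
    by (rule nn_integral_sum[symmetric]) auto
  also have "\<dots> \<le> (\<integral>\<^sup>+z\<in>S. h z \<partial>Vol \<alpha>)"
  proof (intro nn_integral_mono)
    fix z
    show "(\<Sum>j\<in>G. c j * indicator (top_half j) z) \<le> h z * indicator S z"
    proof (cases "\<exists>i\<in>G. z \<in> top_half i")
      case True
      then obtain i where i: "i \<in> G" "z \<in> top_half i" by blast
      have eq: "j = i" if "j \<in> G" "z \<in> top_half j" for j
        using that i e[of i] e[of j] by (cases i; cases j) (auto dest: top_half_disjoint)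
      have "(\<Sum>j\<in>G. c j * indicator (top_half j) z) = (\<Sum>j\<in>G. if j = i then c i else 0)"
      proof (intro sum.cong refl)
        fix j assume "j \<in> G"
        with i eq[of j] show "c j * indicator (top_half j) z = (if j = i then c i else 0)"
          by (cases "z \<in> top_half j") auto
      qed
      also have "\<dots> = c i" using i \<open>finite G\<close> by simp
      also have "\<dots> \<le> h z" using i h top_half_subset by blast
      finally show ?thesis using i S[of i] top_half_subset[of i] by (auto simp: subset_iff)
    next
      case False
      then have "(\<Sum>j\<in>G. c j * indicator (top_half j) z) = 0" by (intro sum.neutral) auto
      then show ?thesis by simp
    qed
  qed
  finally show ?thesis by (simp add: mult_left_mono)
qed

text \<open>The 2 counts the grids, the 6 is the enlargement of a box to a cell, and the last factor
  is the constant of the embedding theorem.\<close>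

definition two_weight_const :: "real \<Rightarrow> real \<Rightarrow> real \<Rightarrow> real \<Rightarrow> real" where
  "two_weight_const p q \<alpha> \<gamma> =
     (2 * 6 powr ((2 + \<alpha> - \<gamma>) * q)) powr (1 / q) * (2 powr p * p / (p - 1)) powr (1 / p)"

text \<open>The common core of all three estimates. The coefficients \<open>a\<close> are left open:
  they must satisfy a packing condition relative to \<open>v\<close>, with constant K, and be large
  enough for the testing condition, with constant L. The first two estimates take the masses of
  cells, the third a geometric mean.\<close>

lemma maxfun_two_weight:
  assumes p: "1 < p" "p \<le> q" and "0 \<le> 2 + \<alpha> - \<gamma>"
    and [measurable]: "v \<in> borel_measurable borel" "\<omega> \<in> borel_measurable borel" "f \<in> borel_measurable borel"
    and carleson: "\<And>G i. finite G \<Longrightarrow> (\<And>j. j \<in> G \<Longrightarrow> fst j = fst i) \<Longrightarrow> (\<And>j. j \<in> G \<Longrightarrow> cell j \<subseteq> cell i) \<Longrightarrow>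
      wmeas \<alpha> v (cell i) < top \<Longrightarrow> sum a G \<le> K * wmeas \<alpha> v (cell i)"
    and fin: "\<And>i. wmeas \<alpha> \<omega> (cell i) \<noteq> 0 \<Longrightarrow> wmeas \<alpha> v (cell i) < top"
    and test: "\<And>i. wmeas \<alpha> \<omega> (cell i) \<noteq> 0 \<Longrightarrow> epowr (wmeas \<alpha> \<omega> (cell i)) (p / q) * epowr (wmeas \<alpha> v (cell i)) p
      \<le> L * a i * ennreal (side i powr ((2 + \<alpha> - \<gamma>) * p))"
    and g: "\<And>i. wmeas \<alpha> \<omega> (cell i) \<noteq> 0 \<Longrightarrow> wmeas \<alpha> g (cell i) \<le> wmeas \<alpha> (\<lambda>z. f z * v z) (cell i)"
  shows "wnorm q \<alpha> \<omega> (maxfun \<alpha> \<gamma> g)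
    \<le> ennreal (two_weight_const p q \<alpha> \<gamma>) * epowr L (1 / p) * epowr K (1 / p) * wnorm p \<alpha> v f"
proof -
  let ?d = "2 + \<alpha> - \<gamma>" and ?Cp = "2 powr p * p / (p - 1)"
  define \<Phi> where "\<Phi> = (\<integral>\<^sup>+z. epowr (f z) p * v z \<partial>Vol \<alpha>)"
  define X where "X i = ennreal (side i powr - ?d) * (\<integral>\<^sup>+w\<in>cell i. g w \<partial>Vol \<alpha>)" for i
  define W where "W i = wmeas \<alpha> \<omega> (cell i)" for i
  define N where "N i = wmeas \<alpha> v (cell i)" for i
  define A where "A i = wmeas \<alpha> (\<lambda>z. f z * v z) (cell i) / N i" for i
  define B where "B = L * (ennreal ?Cp * K * \<Phi>)"
  have pq: "0 < p" "0 < q" "1 \<le> q / p" using p by auto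
  have summand: "epowr (X i) p * epowr (W i) (p / q) \<le> L * (a i * epowr (A i) p)" if "W i \<noteq> 0" for i
  proof -
    have N: "N i < top" using fin that by (simp add: W_def N_def)
    have "wmeas \<alpha> (\<lambda>z. f z * v z) (cell i) = A i * N i"
    \<comment> \<open>In a cell of mass 0, \<open>v\<close> vanishes almost everywhere and so does f
      v; the quotient \<open>A i\<close> may then be multiplied back by \<open>N i\<close>.\<close>
    proof (cases "N i = 0")
      case True
      then have "AE z in Vol \<alpha>. v z * indicator (cell i) z = 0"
        by (simp add: N_def wmeas_def nn_integral_0_iff_AE)
      then have "AE z in Vol \<alpha>. f z * v z * indicator (cell i) z = 0"
        by eventually_elim auto
      then have "wmeas \<alpha> (\<lambda>z. f z * v z) (cell i) = 0"
        unfolding wmeas_def by (subst nn_integral_0_iff_AE) auto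
      then show ?thesis using True by simp
    next
      case False
      then show ?thesis using N by (simp add: A_def ennreal_divide_times)
    qed
    then have "X i \<le> ennreal (side i powr - ?d) * (A i * N i)"
      unfolding X_def using g[of i] that by (intro mult_left_mono) (auto simp: wmeas_def W_def)
    then have "epowr (X i) p * epowr (W i) (p / q)
        \<le> epowr (ennreal (side i powr - ?d) * (A i * N i)) p * epowr (W i) (p / q)"
      using pq by (intro mult_right_mono epowr_mono) auto
    also have "\<dots> = ennreal (side i powr (- ?d * p)) * epowr (A i) p * (epowr (W i) (p / q) * epowr (N i) p)"
      by (simp add: epowr_mult powr_powr mult_ac)
    also have "\<dots> \<le> ennreal (side i powr (- ?d * p)) * epowr (A i) p * (L * a i * ennreal (side i powr (?d * p)))"
      using test[of i] that by (intro mult_left_mono) (auto simp: W_def N_def)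
    also have "\<dots> = L * (a i * epowr (A i) p) * (ennreal (side i powr (- ?d * p)) * ennreal (side i powr (?d * p)))"
      by (simp only: mult_ac)
    also have "ennreal (side i powr (- ?d * p)) * ennreal (side i powr (?d * p)) = 1"
      using less_imp_neq[OF side_pos[of i]]
      by (simp only: ennreal_mult[symmetric] powr_ge_zero powr_add[symmetric] distrib_right[symmetric]) simp
    finally show ?thesis by simp
  qed
  have one_grid: "(\<Sum>i\<in>G. epowr (X i) q * W i) \<le> epowr B (q / p)"
    if "finite G" and e: "\<And>i. i \<in> G \<Longrightarrow> fst i = e" for G e
  proof -
    define H where "H = {i \<in> G. W i \<noteq> 0}"
    have "finite H" using that by (simp add: H_def)
    have "(\<Sum>i\<in>G. epowr (X i) q * W i) = (\<Sum>i\<in>H. epowr (X i) q * W i)"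
      using that by (intro sum.mono_neutral_right) (auto simp: H_def)
    \<comment> \<open>Writing each term as a power q / p gives \<open>W i\<close> the exponent p / q
      of the testing condition.\<close>
    also have "\<dots> = (\<Sum>i\<in>H. epowr (epowr (X i) p * epowr (W i) (p / q)) (q / p))"
      using pq by (simp add: epowr_mult)
    also have "\<dots> \<le> (\<Sum>i\<in>H. epowr (L * (a i * epowr (A i) p)) (q / p))"
      using summand pq by (intro sum_mono epowr_mono) (auto simp: H_def)
    also have "\<dots> \<le> epowr (\<Sum>i\<in>H. L * (a i * epowr (A i) p)) (q / p)"
      using pq \<open>finite H\<close> by (intro epowr_sum_le) auto
    also have "\<dots> \<le> epowr B (q / p)"
    proof (rule epowr_mono)
      have "(\<Sum>i\<in>H. a i * epowr (A i) p) \<le> ennreal ?Cp * K * \<Phi>"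
        unfolding A_def N_def \<Phi>_def
      proof (rule carleson_embedding_cells[where e = e])
        fix i assume "i \<in> H"
        then show "wmeas \<alpha> v (cell i) < top" using fin by (simp add: H_def W_def)
        with \<open>i \<in> H\<close> \<open>finite G\<close> e
        show "(\<Sum>j | j \<in> H \<and> cell j \<subseteq> cell i. a j) \<le> K * wmeas \<alpha> v (cell i)"
          by (intro carleson) (auto simp: H_def)
      qed (use \<open>finite H\<close> e p in \<open>auto simp: H_def\<close>)
      then show "(\<Sum>i\<in>H. L * (a i * epowr (A i) p)) \<le> B"
        unfolding B_def by (simp only: sum_distrib_left[symmetric] mult_left_mono zero_le)
    qed (use pq in auto)
    finally show ?thesis .
  qed
  have "(\<integral>\<^sup>+i. epowr (X i) q * W i \<partial>count_space UNIV) \<le> 2 * epowr B (q / p)"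
  proof (rule nn_integral_count_space_le)
    fix G :: "grid_index set" assume "finite G"
    have "(\<Sum>i\<in>G. epowr (X i) q * W i) = (\<Sum>i\<in>{i \<in> G. fst i}. epowr (X i) q * W i) + (\<Sum>i\<in>{i \<in> G. \<not> fst i}. epowr (X i) q * W i)"
      using \<open>finite G\<close> by (subst sum.union_disjoint[symmetric]) (auto intro!: sum.cong)
    also have "\<dots> \<le> epowr B (q / p) + epowr B (q / p)"
      using \<open>finite G\<close> by (intro add_mono one_grid[where e = True] one_grid[where e = False]) auto
    finally show "(\<Sum>i\<in>G. epowr (X i) q * W i) \<le> 2 * epowr B (q / p)" by (simp only: mult_2)
  qed
  then have "(\<integral>\<^sup>+z. epowr (maxfun \<alpha> \<gamma> g z) q * \<omega> z \<partial>Vol \<alpha>) \<le> ennreal (6 powr (?d * q)) * (2 * epowr B (q / p))"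
    using nn_integral_maxfun_le_sum[of \<alpha> \<gamma> q \<omega> g] assms(3) pq unfolding X_def W_def
    by (meson \<open>\<omega> \<in> borel_measurable borel\<close> mult_left_mono order_trans zero_le)
  then have "wnorm q \<alpha> \<omega> (maxfun \<alpha> \<gamma> g) \<le> epowr (ennreal (6 powr (?d * q)) * (2 * epowr B (q / p))) (1 / q)"
    unfolding wnorm_def using pq by (intro epowr_mono) auto
  also have "\<dots> = epowr (ennreal (2 * 6 powr (?d * q))) (1 / q) * epowr B (1 / p)"
    using pq by (simp add: epowr_mult ennreal_mult mult_ac ennreal_numeral[symmetric] del: ennreal_numeral)
  also have "\<dots> = ennreal (two_weight_const p q \<alpha> \<gamma>) * epowr L (1 / p) * epowr K (1 / p) * epowr \<Phi> (1 / p)"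
    using p epowr_ennreal[of 2 "1 / q"]
    by (simp add: B_def epowr_mult two_weight_const_def ennreal_mult powr_mult mult_ac)
  finally show ?thesis by (simp add: wnorm_def \<Phi>_def)
qed

section \<open>Packing by the \<open>Binf\<close> constant\<close>

lemma wmeas_cell: "wmeas \<alpha> v (cell i) = wmeas \<alpha> v (Qbox (left i) (left i + side i))"
  by (simp add: wmeas_def set_nn_integral_Qbox cell_def)

lemma cell_subset_Qbox: "cell i \<subseteq> Qbox (left i) (left i + side i)"
  by (auto simp: cell_def Dbox_def Qbox_def)

text \<open>On a cell inside \<open>cell i\<close>, the normalised mass of \<open>v\<close> is a
  competitor in the supremum defining the localised maximal function. Summing over disjoint top
  halves gives the integral of that function, which \<open>Binf\<close> compares with the mass of
  \<open>v\<close>.\<close>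

lemma Binf_carleson:
  assumes \<alpha>: "-1 < \<alpha>" and [measurable]: "v \<in> borel_measurable borel" and Binf: "Binf \<alpha> v < top"
    and G: "finite G" "\<And>j. j \<in> G \<Longrightarrow> fst j = fst i" "\<And>j. j \<in> G \<Longrightarrow> cell j \<subseteq> cell i"
    and fin: "wmeas \<alpha> v (cell i) < top"
  shows "(\<Sum>j\<in>G. wmeas \<alpha> v (cell j)) \<le> ennreal (1 / t0 \<alpha>) * Binf \<alpha> v * wmeas \<alpha> v (cell i)"
proof -
  define Q where "Q i = Qbox (left i) (left i + side i)" for i
  define h where "h = maxfun \<alpha> 0 (\<lambda>w. v w * indicator (Q i) w)"
  define c where "c j = ennreal (side j powr - (2 + \<alpha>)) * wmeas \<alpha> v (cell j)" for j
  have "(\<Sum>j\<in>G. wmeas \<alpha> v (cell j)) = (\<Sum>j\<in>G. c j * ennreal (side j powr (2 + \<alpha>)))"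
  proof (intro sum.cong refl)
    fix j
    have "ennreal (side j powr - (2 + \<alpha>)) * ennreal (side j powr (2 + \<alpha>)) = 1"
      using less_imp_neq[OF side_pos[of j]]
      by (simp only: ennreal_mult[symmetric] powr_ge_zero powr_add[symmetric]) simp
    then show "wmeas \<alpha> v (cell j) = c j * ennreal (side j powr (2 + \<alpha>))"
      unfolding c_def by (metis mult.assoc mult.commute mult_1)
  qed
  also have "\<dots> \<le> ennreal (1 / t0 \<alpha>) * (\<integral>\<^sup>+z\<in>Q i. h z \<partial>Vol \<alpha>)"
  proof (rule top_half_packing[OF \<alpha> G(1,2)])
    fix j assume "j \<in> G"
    then show "cell j \<subseteq> Q i" using G(3)[of j] cell_subset_Qbox[of i] by (simp add: Q_def)
    fix z assume "z \<in> cell j"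
    have "c j \<le> ennreal (side j powr - (2 + \<alpha>)) * (\<integral>\<^sup>+w\<in>Q j. v w * indicator (Q i) w \<partial>Vol \<alpha>)"
      unfolding c_def wmeas_def using cell_subset_Qbox[of j] \<open>cell j \<subseteq> Q i\<close>
      by (intro mult_left_mono nn_integral_mono) (auto simp: Q_def split: split_indicator)
    also have "\<dots> \<le> h z"
      unfolding h_def maxfun_def using cell_subset_Qbox[of j] \<open>z \<in> cell j\<close>
      by (intro SUP_upper2[of "(left j, left j + side j)"]) (auto simp: Q_def)
    finally show "c j \<le> h z" .
  qed
  also have "(\<integral>\<^sup>+z\<in>Q i. h z \<partial>Vol \<alpha>) \<le> Binf \<alpha> v * wmeas \<alpha> v (cell i)"
  proof -
    define I where "I = (\<integral>\<^sup>+z\<in>Q i. h z \<partial>Vol \<alpha>)"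
    have le: "I / wmeas \<alpha> v (cell i) \<le> Binf \<alpha> v"
      unfolding Binf_def wmeas_cell I_def h_def Q_def
      by (intro SUP_upper2[of "(left i, left i + side i)"]) (auto simp: Ivs_def)
    show ?thesis
    proof (cases "wmeas \<alpha> v (cell i) = 0")
      \<comment> \<open>Division by 0 gives \<open>top\<close> unless the numerator is 0, so a
        finite \<open>Binf\<close> forces \<open>I = 0\<close>.\<close>
      case True
      with le Binf have "I = 0" by (cases "I = 0") (auto simp: ennreal_divide_zero top_unique)
      then show ?thesis by (simp add: I_def)
    next
      case False
      then have "I = I / wmeas \<alpha> v (cell i) * wmeas \<alpha> v (cell i)"
        using fin by (simp add: ennreal_divide_times)
      also have "\<dots> \<le> Binf \<alpha> v * wmeas \<alpha> v (cell i)" using le by (intro mult_right_mono) auto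
      finally show ?thesis by (simp add: I_def)
    qed
  qed
  finally show ?thesis by (simp add: mult_left_mono mult.assoc)
qed

lemma maxfun_two_weight_Binf:
  assumes p: "1 < p" "p \<le> q" and "0 \<le> 2 + \<alpha> - \<gamma>" and \<alpha>: "-1 < \<alpha>"
    and [measurable]: "v \<in> borel_measurable borel" "\<omega> \<in> borel_measurable borel" "f \<in> borel_measurable borel"
    and fin: "L < top" "Binf \<alpha> v < top"
    and test: "\<And>i. epowr (wmeas \<alpha> \<omega> (cell i)) (p / q) * epowr (wmeas \<alpha> v (cell i)) (p - 1)
      \<le> L * ennreal (side i powr ((2 + \<alpha> - \<gamma>) * p))"
    and g: "\<And>i. wmeas \<alpha> \<omega> (cell i) \<noteq> 0 \<Longrightarrow> wmeas \<alpha> v (cell i) < top \<Longrightarrow>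
      wmeas \<alpha> g (cell i) \<le> wmeas \<alpha> (\<lambda>z. f z * v z) (cell i)"
  shows "wnorm q \<alpha> \<omega> (maxfun \<alpha> \<gamma> g)
    \<le> ennreal (two_weight_const p q \<alpha> \<gamma> * (1 / t0 \<alpha>) powr (1 / p)) * epowr L (1 / p)
      * epowr (Binf \<alpha> v) (1 / p) * wnorm p \<alpha> v f"
proof -
  \<comment> \<open>An infinite \<open>v\<close>-mass times a nonzero \<open>\<omega>\<close>-mass
    would make the left side of the testing condition infinite, against
    \<open>L < top\<close>.\<close>
  have v_fin: "wmeas \<alpha> v (cell i) < top" if "wmeas \<alpha> \<omega> (cell i) \<noteq> 0" for i
  proof (rule ccontr)
    assume "\<not> wmeas \<alpha> v (cell i) < top"
    then have "wmeas \<alpha> v (cell i) = top" by (simp add: less_top[symmetric])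
    with test[of i] that fin show False
      by (auto simp: ennreal_mult_top top_unique ennreal_mult_eq_top_iff)
  qed
  have "wnorm q \<alpha> \<omega> (maxfun \<alpha> \<gamma> g) \<le> ennreal (two_weight_const p q \<alpha> \<gamma>) * epowr L (1 / p)
      * epowr (ennreal (1 / t0 \<alpha>) * Binf \<alpha> v) (1 / p) * wnorm p \<alpha> v f"
  proof (rule maxfun_two_weight[where a = "\<lambda>i. wmeas \<alpha> v (cell i)"])
    show "wmeas \<alpha> v (cell i) < top" if "wmeas \<alpha> \<omega> (cell i) \<noteq> 0" for i
      using v_fin that .
    show "wmeas \<alpha> g (cell i) \<le> wmeas \<alpha> (\<lambda>z. f z * v z) (cell i)" if "wmeas \<alpha> \<omega> (cell i) \<noteq> 0" for i
      using g v_fin that by blast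
    show "sum (\<lambda>i. wmeas \<alpha> v (cell i)) G \<le> ennreal (1 / t0 \<alpha>) * Binf \<alpha> v * wmeas \<alpha> v (cell i)"
      if "finite G" "\<And>j. j \<in> G \<Longrightarrow> fst j = fst i" "\<And>j. j \<in> G \<Longrightarrow> cell j \<subseteq> cell i"
        "wmeas \<alpha> v (cell i) < top" for G i
      using that by (intro Binf_carleson[OF \<alpha> _ fin(2)]) auto
    show "epowr (wmeas \<alpha> \<omega> (cell i)) (p / q) * epowr (wmeas \<alpha> v (cell i)) p
      \<le> L * wmeas \<alpha> v (cell i) * ennreal (side i powr ((2 + \<alpha> - \<gamma>) * p))" for i
    proof -
      have "epowr (wmeas \<alpha> v (cell i)) p = epowr (wmeas \<alpha> v (cell i)) (p - 1) * wmeas \<alpha> v (cell i)"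
        using epowr_add[of _ "p - 1" 1] by simp
      then have "epowr (wmeas \<alpha> \<omega> (cell i)) (p / q) * epowr (wmeas \<alpha> v (cell i)) p
          = epowr (wmeas \<alpha> \<omega> (cell i)) (p / q) * epowr (wmeas \<alpha> v (cell i)) (p - 1) * wmeas \<alpha> v (cell i)"
        by (simp add: mult.assoc)
      also have "\<dots> \<le> L * ennreal (side i powr ((2 + \<alpha> - \<gamma>) * p)) * wmeas \<alpha> v (cell i)"
        using test by (rule mult_right_mono) simp
      finally show ?thesis by (simp only: mult_ac)
    qed
  qed (use assms in auto)
  also have "\<dots> = ennreal (two_weight_const p q \<alpha> \<gamma> * (1 / t0 \<alpha>) powr (1 / p)) * epowr L (1 / p)
      * epowr (Binf \<alpha> v) (1 / p) * wnorm p \<alpha> v f"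
    using p t0_pos[OF \<alpha>] by (simp add: epowr_mult ennreal_mult two_weight_const_def mult_ac)
  finally show ?thesis .
qed

section \<open>The three characteristics\<close>

lemma conj_exp_props:
  assumes "1 < p"
  shows "p / conj_exp p = p - 1" "conj_exp p * p - conj_exp p = p"
proof -
  show "p / conj_exp p = p - 1" using assms by (simp add: conj_exp_def)
  have "conj_exp p * p - conj_exp p = conj_exp p * (p - 1)" by (simp add: right_diff_distrib)
  then show "conj_exp p * p - conj_exp p = p" using assms by (simp add: conj_exp_def)
qed

lemma ennreal_le_mult_of_divide_le:
  assumes "x / ennreal c \<le> y" "0 < c"
  shows "x \<le> y * ennreal c"
proof -
  have "x = x / ennreal c * ennreal c"
    using assms(2) by (simp add: ennreal_divide_times ennreal_eq_0_iff)
  also have "\<dots> \<le> y * ennreal c"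
    using assms(1) by (rule mult_right_mono) simp
  finally show ?thesis .
qed

lemma volA_cell_powr:
  assumes "-1 < \<alpha>"
  shows "volA \<alpha> (Qbox (left i) (left i + side i)) powr r = v0 \<alpha> powr r * side i powr ((2 + \<alpha>) * r)"
  using assms v0_pos[OF assms] by (simp add: volA_Qbox powr_mult powr_powr)

text \<open>As p / p' = p - 1, the characteristic at the box around a cell is the testing condition
  for v = \<open>\<sigma>\<close>. It is normalised by volumes and \<open>maxfun\<close> by side
  lengths; the power of \<open>v0 \<alpha>\<close> converts one into the other.\<close>

lemma Achar_bound:
  assumes p: "1 < p" "p \<le> q" and \<alpha>: "-1 < \<alpha>" and \<gamma>: "0 \<le> \<gamma>" "\<gamma> < 2 + \<alpha>"
    and "is_weight \<sigma>" "is_weight \<omega>" and f: "f \<in> borel_measurable borel"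
    and fin: "Achar p q \<alpha> \<gamma> \<sigma> \<omega> < top" "Binf \<alpha> (\<lambda>z. ennreal (\<sigma> z)) < top"
  shows "wnorm q \<alpha> (\<lambda>z. ennreal (\<omega> z)) (maxfun \<alpha> \<gamma> (\<lambda>z. ennreal \<bar>\<sigma> z * f z\<bar>))
    \<le> ennreal (two_weight_const p q \<alpha> \<gamma> * (1 / t0 \<alpha>) powr (1 / p) * v0 \<alpha> powr (1 - \<gamma> / (2 + \<alpha>)))
      * epowr (Achar p q \<alpha> \<gamma> \<sigma> \<omega>) (1 / p) * epowr (Binf \<alpha> (\<lambda>z. ennreal (\<sigma> z))) (1 / p)
      * wnorm p \<alpha> (\<lambda>z. ennreal (\<sigma> z)) (\<lambda>z. ennreal \<bar>f z\<bar>)"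
proof -
  have [measurable]: "\<sigma> \<in> borel_measurable borel" "\<omega> \<in> borel_measurable borel" "f \<in> borel_measurable borel"
    using assms by (auto simp: is_weight_def)
  have \<sigma>: "0 \<le> \<sigma> z" for z using assms by (auto simp: is_weight_def)
  let ?r = "p * (1 - \<gamma> / (2 + \<alpha>))"
  have r: "(2 + \<alpha>) * ?r = (2 + \<alpha> - \<gamma>) * p" using \<alpha> by (simp add: field_simps)
  define L where "L = Achar p q \<alpha> \<gamma> \<sigma> \<omega> * ennreal (v0 \<alpha> powr ?r)"
  have "wnorm q \<alpha> (\<lambda>z. ennreal (\<omega> z)) (maxfun \<alpha> \<gamma> (\<lambda>z. ennreal \<bar>\<sigma> z * f z\<bar>))
    \<le> ennreal (two_weight_const p q \<alpha> \<gamma> * (1 / t0 \<alpha>) powr (1 / p)) * epowr L (1 / p)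
      * epowr (Binf \<alpha> (\<lambda>z. ennreal (\<sigma> z))) (1 / p) * wnorm p \<alpha> (\<lambda>z. ennreal (\<sigma> z)) (\<lambda>z. ennreal \<bar>f z\<bar>)"
  proof (rule maxfun_two_weight_Binf)
    show "L < top" using fin by (simp add: L_def ennreal_mult_less_top)
    show "wmeas \<alpha> (\<lambda>z. ennreal \<bar>\<sigma> z * f z\<bar>) (cell i) \<le> wmeas \<alpha> (\<lambda>z. ennreal \<bar>f z\<bar> * ennreal (\<sigma> z)) (cell i)" for i
      using \<sigma> by (simp add: abs_mult ennreal_mult mult.commute)
    show "epowr (wmeas \<alpha> (\<lambda>z. ennreal (\<omega> z)) (cell i)) (p / q) * epowr (wmeas \<alpha> (\<lambda>z. ennreal (\<sigma> z)) (cell i)) (p - 1)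
      \<le> L * ennreal (side i powr ((2 + \<alpha> - \<gamma>) * p))" for i
    proof -
      let ?Q = "Qbox (left i) (left i + side i)"
      have "epowr (wmeas \<alpha> (\<lambda>z. ennreal (\<omega> z)) ?Q) (p / q) * epowr (wmeas \<alpha> (\<lambda>z. ennreal (\<sigma> z)) ?Q) (p / conj_exp p)
          / ennreal (volA \<alpha> ?Q powr ?r) \<le> Achar p q \<alpha> \<gamma> \<sigma> \<omega>"
        unfolding Achar_def by (rule SUP_upper2[of "(left i, left i + side i)"]) (auto simp: Ivs_def)
      then have "epowr (wmeas \<alpha> (\<lambda>z. ennreal (\<omega> z)) ?Q) (p / q) * epowr (wmeas \<alpha> (\<lambda>z. ennreal (\<sigma> z)) ?Q) (p / conj_exp p)
          \<le> Achar p q \<alpha> \<gamma> \<sigma> \<omega> * ennreal (volA \<alpha> ?Q powr ?r)"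
        by (rule ennreal_le_mult_of_divide_le) (use v0_pos[OF \<alpha>] less_imp_neq[OF side_pos[of i]] in \<open>simp add: volA_cell_powr[OF \<alpha>]\<close>)
      then show ?thesis
        using p by (simp add: volA_cell_powr[OF \<alpha>] r L_def ennreal_mult conj_exp_props wmeas_cell mult.assoc)
    qed
  qed (use assms in auto)
  also have "epowr L (1 / p) = epowr (Achar p q \<alpha> \<gamma> \<sigma> \<omega>) (1 / p) * ennreal (v0 \<alpha> powr (1 - \<gamma> / (2 + \<alpha>)))"
    using p by (simp add: L_def epowr_mult powr_powr)
  finally show ?thesis
    by (simp add: ennreal_mult two_weight_const_def t0_pos[OF \<alpha>] mult_ac)
qed

text \<open>The right-hand norms agree because (|f| / u)^p u = |f|^p \<sigma>^(p' p - p') and p' p -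
  p' = p.\<close>

lemma Cchar_bound:
  assumes p: "1 < p" "p \<le> q" and \<alpha>: "-1 < \<alpha>" and \<gamma>: "0 \<le> \<gamma>" "\<gamma> < 2 + \<alpha>"
    and "is_weight \<sigma>" "is_weight \<omega>" and f: "f \<in> borel_measurable borel"
    and fin: "Cchar p q \<alpha> \<gamma> \<sigma> \<omega> < top" "Binf \<alpha> (uw p \<sigma>) < top"
  shows "wnorm q \<alpha> (\<lambda>z. ennreal (\<omega> z)) (maxfun \<alpha> \<gamma> (\<lambda>z. ennreal \<bar>f z\<bar>))
    \<le> ennreal (two_weight_const p q \<alpha> \<gamma> * (1 / t0 \<alpha>) powr (1 / p) * v0 \<alpha> powr (1 - \<gamma> / (2 + \<alpha>)))
      * Cchar p q \<alpha> \<gamma> \<sigma> \<omega> * epowr (Binf \<alpha> (uw p \<sigma>)) (1 / p)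
      * wnorm p \<alpha> (\<lambda>z. 1) (\<lambda>z. ennreal \<bar>\<sigma> z * f z\<bar>)"
proof -
  have [measurable]: "\<sigma> \<in> borel_measurable borel" "\<omega> \<in> borel_measurable borel" "f \<in> borel_measurable borel"
    using assms by (auto simp: is_weight_def)
  have [measurable]: "uw p \<sigma> \<in> borel_measurable borel"
    unfolding uw_def by measurable
  have \<sigma>: "0 \<le> \<sigma> z" for z using assms by (auto simp: is_weight_def)
  \<comment> \<open>This is |f| / u, written so that it is 0 where \<open>\<sigma>\<close> = 0 and u
    is infinite; there \<open>F z * uw p \<sigma> z\<close> is 0 by
    \<open>0 * top = 0\<close>.\<close>
  define F where "F z = ennreal (\<bar>f z\<bar> * \<sigma> z powr conj_exp p)" for z
  have [measurable]: "F \<in> borel_measurable borel" unfolding F_def by measurable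
  have F_uw: "F z * uw p \<sigma> z = ennreal \<bar>f z\<bar>" if "\<sigma> z \<noteq> 0" for z
    using that \<sigma>[of z] by (simp add: F_def uw_def ennreal_mult[symmetric] mult.assoc powr_add[symmetric])
  let ?r = "1 - \<gamma> / (2 + \<alpha>)"
  have r: "(2 + \<alpha>) * (?r * p) = (2 + \<alpha> - \<gamma>) * p" using \<alpha> by (simp add: field_simps)
  \<comment> \<open>\<open>Cchar\<close> has the scaling of a norm, while the testing condition is
    one of p-th powers.\<close>
  define L where "L = epowr (Cchar p q \<alpha> \<gamma> \<sigma> \<omega> * ennreal (v0 \<alpha> powr ?r)) p"
  have "wnorm q \<alpha> (\<lambda>z. ennreal (\<omega> z)) (maxfun \<alpha> \<gamma> (\<lambda>z. ennreal \<bar>f z\<bar>))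
    \<le> ennreal (two_weight_const p q \<alpha> \<gamma> * (1 / t0 \<alpha>) powr (1 / p)) * epowr L (1 / p)
      * epowr (Binf \<alpha> (uw p \<sigma>)) (1 / p) * wnorm p \<alpha> (uw p \<sigma>) F"
  proof (rule maxfun_two_weight_Binf)
    show "L < top" using fin by (simp add: L_def ennreal_mult_less_top)
    show "wmeas \<alpha> (\<lambda>z. ennreal \<bar>f z\<bar>) (cell i) \<le> wmeas \<alpha> (\<lambda>z. F z * uw p \<sigma> z) (cell i)"
      if "wmeas \<alpha> (uw p \<sigma>) (cell i) < top" for i
    proof -
      \<comment> \<open>A finite mass of u makes the zeros of \<open>\<sigma>\<close> in the cell a
        null set, so the failure of \<open>F_uw\<close> there does no harm.\<close>
      have "AE z in Vol \<alpha>. uw p \<sigma> z * indicator (cell i) z \<noteq> \<infinity>"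
        using that by (intro nn_integral_PInf_AE) (auto simp: wmeas_def)
      then have "AE z in Vol \<alpha>. ennreal \<bar>f z\<bar> * indicator (cell i) z \<le> F z * uw p \<sigma> z * indicator (cell i) z"
      proof eventually_elim
        case (elim z)
        then have "\<sigma> z \<noteq> 0" if "z \<in> cell i" using that by (auto simp: uw_def)
        then show ?case using F_uw[of z] by (auto simp: indicator_def)
      qed
      then show ?thesis unfolding wmeas_def by (rule nn_integral_mono_AE)
    qed
    show "epowr (wmeas \<alpha> (\<lambda>z. ennreal (\<omega> z)) (cell i)) (p / q) * epowr (wmeas \<alpha> (uw p \<sigma>) (cell i)) (p - 1)
      \<le> L * ennreal (side i powr ((2 + \<alpha> - \<gamma>) * p))" for i
    proof -
      let ?Q = "Qbox (left i) (left i + side i)"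
      have Q: "0 < volA \<alpha> ?Q"
        using v0_pos[OF \<alpha>] less_imp_neq[OF side_pos[of i]] by (simp add: volA_Qbox[OF \<alpha>])
      have "ennreal (volA \<alpha> ?Q powr (\<gamma> / (2 + \<alpha>) - 1)) * epowr (wmeas \<alpha> (\<lambda>z. ennreal (\<omega> z)) ?Q) (1 / q)
          * epowr (wmeas \<alpha> (uw p \<sigma>) ?Q) (1 / conj_exp p) \<le> Cchar p q \<alpha> \<gamma> \<sigma> \<omega>"
        unfolding Cchar_def by (rule SUP_upper2[of "(left i, left i + side i)"]) (auto simp: Ivs_def)
      then have "ennreal (volA \<alpha> ?Q powr ?r) * (ennreal (volA \<alpha> ?Q powr - ?r) *
          (epowr (wmeas \<alpha> (\<lambda>z. ennreal (\<omega> z)) ?Q) (1 / q) * epowr (wmeas \<alpha> (uw p \<sigma>) ?Q) (1 / conj_exp p)))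
          \<le> ennreal (volA \<alpha> ?Q powr ?r) * Cchar p q \<alpha> \<gamma> \<sigma> \<omega>"
        by (intro mult_left_mono) (auto simp: mult.assoc)
      moreover have "ennreal (volA \<alpha> ?Q powr ?r) * ennreal (volA \<alpha> ?Q powr - ?r) = 1"
        using less_imp_neq[OF Q]
        by (simp only: ennreal_mult[symmetric] powr_ge_zero powr_add[symmetric]) simp
      ultimately have "epowr (wmeas \<alpha> (\<lambda>z. ennreal (\<omega> z)) ?Q) (1 / q) * epowr (wmeas \<alpha> (uw p \<sigma>) ?Q) (1 / conj_exp p)
          \<le> Cchar p q \<alpha> \<gamma> \<sigma> \<omega> * ennreal (volA \<alpha> ?Q powr ?r)"
        by (simp add: mult.assoc[symmetric]) (simp add: mult.commute)
      then have "epowr (epowr (wmeas \<alpha> (\<lambda>z. ennreal (\<omega> z)) ?Q) (1 / q) * epowr (wmeas \<alpha> (uw p \<sigma>) ?Q) (1 / conj_exp p)) p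
          \<le> epowr (Cchar p q \<alpha> \<gamma> \<sigma> \<omega> * ennreal (volA \<alpha> ?Q powr ?r)) p"
        using p by (intro epowr_mono) auto
      then show ?thesis
        using p by (simp add: volA_cell_powr[OF \<alpha>] L_def epowr_mult ennreal_mult powr_powr r conj_exp_props wmeas_cell mult.assoc)
    qed
  qed (use assms in auto)
  also have "epowr L (1 / p) = Cchar p q \<alpha> \<gamma> \<sigma> \<omega> * ennreal (v0 \<alpha> powr ?r)"
    using p by (simp add: L_def)
  also have "wnorm p \<alpha> (uw p \<sigma>) F = wnorm p \<alpha> (\<lambda>z. 1) (\<lambda>z. ennreal \<bar>\<sigma> z * f z\<bar>)"
  proof -
    have "epowr (F z) p * uw p \<sigma> z = epowr (ennreal \<bar>\<sigma> z * f z\<bar>) p" for z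
    proof (cases "\<sigma> z = 0")
      case False
      have "\<bar>f z\<bar> powr p * \<sigma> z powr (conj_exp p * p) * \<sigma> z powr - conj_exp p = \<bar>\<sigma> z * f z\<bar> powr p"
        using \<sigma>[of z] False conj_exp_props(2)[OF p(1)]
        by (simp add: abs_mult powr_mult mult.assoc powr_add[symmetric] mult.commute)
      then show ?thesis
        using False by (simp add: F_def uw_def powr_mult powr_powr ennreal_mult[symmetric])
    qed (simp add: F_def)
    then show ?thesis by (simp add: wnorm_def)
  qed
  finally show ?thesis
    by (simp add: ennreal_mult two_weight_const_def t0_pos[OF \<alpha>] mult_ac)
qed

section \<open>The logarithmic characteristic\<close>

lemma geom_inv_Qbox: "geom_inv \<alpha> \<sigma> (Qbox a b) = geom_inv \<alpha> \<sigma> (Dbox a (b - a))"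
  unfolding geom_inv_def set_nn_integral_Qbox volA_def emeasure_Qbox ..

text \<open>A zero here would let an infinite mass disappear from \<open>Schar\<close> through
  \<open>0 * top = 0\<close>.\<close>

lemma geom_inv_neq_0: "geom_inv \<alpha> \<sigma> E \<noteq> 0"
  by (simp add: geom_inv_def Let_def ennreal_eq_0_iff not_le)

text \<open>Integrates the tangent line inequality for \<open>exp\<close> at the average of \<open>ln (\<sigma> z) / 2\<close>; both sides
  are arranged so that only nonnegative terms occur.\<close>
lemma inverse_geom_inv_le:
  assumes [measurable]: "\<sigma> \<in> borel_measurable borel" "E \<in> sets borel" and \<sigma>: "\<And>z. 0 \<le> \<sigma> z"
    and V: "emeasure (Vol \<alpha>) E = ennreal V" "0 < V"
  shows "inverse (geom_inv \<alpha> \<sigma> E) \<le> epowr (wmeas \<alpha> (\<lambda>z. ennreal (sqrt (\<sigma> z))) E / ennreal V) 2"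
proof -
  define \<phi> where "\<phi> z = (if \<sigma> z = 0 then top else ennreal (max 0 (- ln (\<sigma> z))))" for z
  define \<psi> where "\<psi> z = (if \<sigma> z = 0 then 0 else ennreal (max 0 (ln (\<sigma> z))))" for z
  have [measurable]: "\<phi> \<in> borel_measurable borel" "\<psi> \<in> borel_measurable borel"
    unfolding \<phi>_def \<psi>_def by measurable
  define P where "P = (\<integral>\<^sup>+z\<in>E. \<phi> z \<partial>Vol \<alpha>)"
  define N where "N = (\<integral>\<^sup>+z\<in>E. \<psi> z \<partial>Vol \<alpha>)"
  define S where "S = wmeas \<alpha> (\<lambda>z. ennreal (sqrt (\<sigma> z))) E"
  have volA: "volA \<alpha> E = V" using V by (simp add: volA_def)
  have G: "geom_inv \<alpha> \<sigma> E = (if P = top \<or> N = top then top else ennreal (exp ((enn2real P - enn2real N) / V)))"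
    unfolding geom_inv_def Let_def P_def N_def \<phi>_def \<psi>_def volA by simp
  consider "P = top \<or> N = top" | "S = top" | "P \<noteq> top" "N \<noteq> top" "S \<noteq> top" by blast
  then show ?thesis
  proof cases
    case 1
    then show ?thesis by (simp add: G)
  next
    case 2
    then show ?thesis unfolding S_def[symmetric] by (simp add: ennreal_top_divide)
  next
    case 3
    then obtain x n s where real: "P = ennreal x" "N = ennreal n" "S = ennreal s" "0 \<le> x" "0 \<le> n" "0 \<le> s"
      by (metis ennreal_cases)
    \<comment> \<open>Half the average of ln \<open>\<sigma>\<close>, so that
      \<open>exp (2 * l)\<close> is the inverse of \<open>geom_inv\<close>.\<close>
    define l where "l = (n - x) / (2 * V)"
    have parts: "max 0 (- y) = max 0 y - y" for y :: real by (simp add: max_def)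
    have pointwise: "ennreal (exp l * (1 + max 0 (- l))) + ennreal (exp l / 2) * \<psi> z
        \<le> ennreal (sqrt (\<sigma> z)) + ennreal (exp l / 2) * \<phi> z + ennreal (exp l * max 0 l)" for z
    proof (cases "\<sigma> z = 0")
      \<comment> \<open>Here \<open>\<phi> z\<close> is \<open>top\<close>, so the right side is
        infinite.\<close>
      case True
      then show ?thesis by (simp add: \<phi>_def ennreal_mult_top)
    next
      case False
      then have "0 < \<sigma> z" using \<sigma>[of z] by simp
      have "exp l * (1 + (ln (\<sigma> z) / 2 - l)) \<le> exp l * exp (ln (\<sigma> z) / 2 - l)"
        by (intro mult_left_mono exp_ge_add_one_self) auto
      also have "\<dots> = sqrt (\<sigma> z)"
        using \<open>0 < \<sigma> z\<close> by (simp add: exp_add[symmetric] ln_sqrt[symmetric])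
      finally have "exp l * (1 + (ln (\<sigma> z) / 2 - l)) \<le> sqrt (\<sigma> z)" .
      then have "exp l * (1 + max 0 (- l)) + exp l / 2 * max 0 (ln (\<sigma> z))
          \<le> sqrt (\<sigma> z) + exp l / 2 * max 0 (- ln (\<sigma> z)) + exp l * max 0 l"
        unfolding parts[of l] parts[of "ln (\<sigma> z)"] by (simp add: algebra_simps)
      then show ?thesis
        using False \<sigma>[of z] by (simp add: \<phi>_def \<psi>_def ennreal_mult[symmetric] ennreal_plus[symmetric] del: ennreal_plus)
    qed
    have "(\<integral>\<^sup>+z. ennreal (exp l * (1 + max 0 (- l))) * indicator E z + ennreal (exp l / 2) * (\<psi> z * indicator E z) \<partial>Vol \<alpha>)
        \<le> (\<integral>\<^sup>+z. ennreal (sqrt (\<sigma> z)) * indicator E z + ennreal (exp l / 2) * (\<phi> z * indicator E z)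
            + ennreal (exp l * max 0 l) * indicator E z \<partial>Vol \<alpha>)"
      using pointwise by (intro nn_integral_mono) (auto split: split_indicator)
    then have "ennreal (exp l * (1 + max 0 (- l))) * ennreal V + ennreal (exp l / 2) * N
        \<le> S + ennreal (exp l / 2) * P + ennreal (exp l * max 0 l) * ennreal V"
      by (simp add: nn_integral_add nn_integral_cmult nn_integral_cmult_indicator V N_def P_def S_def wmeas_def)
    then have "exp l * (1 + max 0 (- l)) * V + exp l / 2 * n \<le> s + exp l / 2 * x + exp l * max 0 l * V"
      using real \<open>0 < V\<close> by (simp add: ennreal_mult[symmetric] ennreal_plus[symmetric] del: ennreal_plus)
    moreover have "exp l * (1 + max 0 (- l)) * V + exp l / 2 * n - (exp l / 2 * x + exp l * max 0 l * V)
        = exp l * (V + (n - x) / 2 - l * V)"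
      unfolding parts[of l] by (simp add: field_simps)
    \<comment> \<open>The tangent point is the average itself, so the linear terms integrate to
      0.\<close>
    moreover have "(n - x) / 2 - l * V = 0" using \<open>0 < V\<close> by (simp add: l_def)
    ultimately have "exp l * V \<le> s" by simp
    then have le: "exp l \<le> s / V" using \<open>0 < V\<close> by (simp add: pos_le_divide_eq)
    have "inverse (geom_inv \<alpha> \<sigma> E) = ennreal (exp (2 * l))"
      using 3 real \<open>0 < V\<close> by (simp add: G inverse_ennreal exp_minus[symmetric] l_def diff_divide_distrib)
    also have "exp (2 * l) = exp l powr 2" by (simp add: exp_double)
    also have "ennreal \<dots> \<le> ennreal ((s / V) powr 2)"
      using le by (intro ennreal_leI powr_mono2) auto
    also have "\<dots> = epowr (S / ennreal V) 2"
      using real \<open>0 < V\<close> by (simp add: divide_ennreal)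
    finally show ?thesis by (simp add: S_def)
  qed
qed

text \<open>Bounding the geometric mean by the average of \<open>\<sigma>\<close> itself would call
  for the embedding theorem at exponent 1, where it fails. The square root moves it to exponent 2
  and leaves the integral of (sqrt \<open>\<sigma>\<close>)^2 = \<open>\<sigma>\<close> on the
  right. The constant is 8 = 2^2 * 2 / (2 - 1), divided by \<open>t0 \<alpha>\<close>.\<close>

lemma geometric_carleson:
  assumes \<alpha>: "-1 < \<alpha>" and [measurable]: "\<sigma> \<in> borel_measurable borel" and \<sigma>: "\<And>z. 0 \<le> \<sigma> z"
    and G: "finite G" "\<And>j. j \<in> G \<Longrightarrow> fst j = fst i" "\<And>j. j \<in> G \<Longrightarrow> cell j \<subseteq> cell i"
  shows "(\<Sum>j\<in>G. ennreal (side j powr (2 + \<alpha>)) * inverse (geom_inv \<alpha> \<sigma> (cell j)))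
    \<le> ennreal (8 / t0 \<alpha>) * wmeas \<alpha> (\<lambda>z. ennreal (\<sigma> z)) (cell i)"
proof -
  \<comment> \<open>Cutting off at \<open>cell i\<close> localises the embedding theorem, whose
    right side is an integral over the whole half-plane.\<close>
  define f where "f z = ennreal (sqrt (\<sigma> z)) * indicator (cell i) z" for z
  have [measurable]: "f \<in> borel_measurable borel" unfolding f_def by measurable
  have one: "wmeas \<alpha> (\<lambda>z. 1) (cell j) = ennreal (v0 \<alpha> * side j powr (2 + \<alpha>))" for j
    by (simp add: wmeas_def) (simp add: cell_def emeasure_Dbox[OF \<alpha>])
  have "(\<Sum>j\<in>G. ennreal (side j powr (2 + \<alpha>)) * inverse (geom_inv \<alpha> \<sigma> (cell j)))
    \<le> (\<Sum>j\<in>G. ennreal (side j powr (2 + \<alpha>)) * epowr (wmeas \<alpha> (\<lambda>z. f z * 1) (cell j) / wmeas \<alpha> (\<lambda>z. 1) (cell j)) 2)"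
  proof (intro sum_mono mult_left_mono)
    fix j assume "j \<in> G"
    have "wmeas \<alpha> (\<lambda>z. ennreal (sqrt (\<sigma> z))) (cell j) = wmeas \<alpha> (\<lambda>z. f z * 1) (cell j)"
      unfolding wmeas_def f_def using G(3)[OF \<open>j \<in> G\<close>] by (intro nn_integral_cong) (auto simp: indicator_def)
    moreover have "inverse (geom_inv \<alpha> \<sigma> (cell j))
        \<le> epowr (wmeas \<alpha> (\<lambda>z. ennreal (sqrt (\<sigma> z))) (cell j) / ennreal (v0 \<alpha> * side j powr (2 + \<alpha>))) 2"
      using \<sigma> v0_pos[OF \<alpha>] less_imp_neq[OF side_pos[of j]]
      by (intro inverse_geom_inv_le) (auto simp: cell_def emeasure_Dbox[OF \<alpha>])
    ultimately show "inverse (geom_inv \<alpha> \<sigma> (cell j)) \<le> epowr (wmeas \<alpha> (\<lambda>z. f z * 1) (cell j) / wmeas \<alpha> (\<lambda>z. 1) (cell j)) 2"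
      by (simp add: one)
  qed simp
  also have "\<dots> \<le> ennreal (2 powr 2 * 2 / (2 - 1)) * ennreal (1 / t0 \<alpha>) * (\<integral>\<^sup>+z. epowr (f z) 2 * 1 \<partial>Vol \<alpha>)"
  proof (rule carleson_embedding_cells[OF _ _ \<open>finite G\<close> G(2)])
    fix j assume "j \<in> G"
    \<comment> \<open>Sparseness of the grid: with constant 1 in place of both \<open>c\<close> and
      \<open>h\<close>, the packing lemma says that the volumes themselves satisfy a packing
      condition.\<close>
    have "(\<Sum>k | k \<in> G \<and> cell k \<subseteq> cell j. 1 * ennreal (side k powr (2 + \<alpha>))) \<le> ennreal (1 / t0 \<alpha>) * (\<integral>\<^sup>+z\<in>cell j. 1 \<partial>Vol \<alpha>)"
      using G by (intro top_half_packing[OF \<alpha>, where e = "fst i"]) auto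
    then show "(\<Sum>k | k \<in> G \<and> cell k \<subseteq> cell j. ennreal (side k powr (2 + \<alpha>))) \<le> ennreal (1 / t0 \<alpha>) * wmeas \<alpha> (\<lambda>z. 1) (cell j)"
      by (simp add: wmeas_def)
  qed (simp_all add: one)
  also have "(\<integral>\<^sup>+z. epowr (f z) 2 * 1 \<partial>Vol \<alpha>) = wmeas \<alpha> (\<lambda>z. ennreal (\<sigma> z)) (cell i)"
    unfolding wmeas_def f_def using \<sigma> by (intro nn_integral_cong) (auto simp: indicator_def)
  also have "ennreal (2 powr 2 * 2 / (2 - 1)) * ennreal (1 / t0 \<alpha>) = ennreal (8 / t0 \<alpha>)"
    using t0_pos[OF \<alpha>] by (subst ennreal_mult[symmetric]) auto
  finally show ?thesis .
qed

text \<open>The additional power of the volume in \<open>Schar\<close> supplies the factor |Q| of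
  the coefficients |Q| / \<open>geom_inv\<close>. Their packing constant depends on \<alpha> alone,
  which is why no \<open>Binf\<close> factor appears.\<close>

lemma Schar_bound:
  assumes p: "1 < p" "p \<le> q" and \<alpha>: "-1 < \<alpha>" and \<gamma>: "0 \<le> \<gamma>" "\<gamma> < 2 + \<alpha>"
    and "is_weight \<sigma>" "is_weight \<omega>" and f: "f \<in> borel_measurable borel"
    and fin: "Schar p q \<alpha> \<gamma> \<sigma> \<omega> < top"
  shows "wnorm q \<alpha> (\<lambda>z. ennreal (\<omega> z)) (maxfun \<alpha> \<gamma> (\<lambda>z. ennreal \<bar>\<sigma> z * f z\<bar>))
    \<le> ennreal (two_weight_const p q \<alpha> \<gamma> * (8 / t0 \<alpha>) powr (1 / p) * v0 \<alpha> powr (1 - \<gamma> / (2 + \<alpha>) + 1 / p))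
      * epowr (Schar p q \<alpha> \<gamma> \<sigma> \<omega>) (1 / p) * wnorm p \<alpha> (\<lambda>z. ennreal (\<sigma> z)) (\<lambda>z. ennreal \<bar>f z\<bar>)"
proof -
  have [measurable]: "\<sigma> \<in> borel_measurable borel" "\<omega> \<in> borel_measurable borel" "f \<in> borel_measurable borel"
    using assms by (auto simp: is_weight_def)
  have \<sigma>: "0 \<le> \<sigma> z" for z using assms by (auto simp: is_weight_def)
  let ?r = "p * (1 - \<gamma> / (2 + \<alpha>)) + 1"
  have r: "(2 + \<alpha>) * ?r = (2 + \<alpha>) + (2 + \<alpha> - \<gamma>) * p" using \<alpha> by (simp add: field_simps)
  define L where "L = Schar p q \<alpha> \<gamma> \<sigma> \<omega> * ennreal (v0 \<alpha> powr ?r)"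
  define W where "W i = wmeas \<alpha> (\<lambda>z. ennreal (\<omega> z)) (cell i)" for i
  define M where "M i = wmeas \<alpha> (\<lambda>z. ennreal (\<sigma> z)) (cell i)" for i
  define c where "c i = v0 \<alpha> powr ?r * side i powr ((2 + \<alpha>) * ?r)" for i
  have c: "0 < c i" for i
    using v0_pos[OF \<alpha>] less_imp_neq[OF side_pos[of i]] by (simp add: c_def)
  have S: "epowr (W i) (p / q) * epowr (M i) p / ennreal (c i) * geom_inv \<alpha> \<sigma> (cell i) \<le> Schar p q \<alpha> \<gamma> \<sigma> \<omega>" for i
  proof -
    have "geom_inv \<alpha> \<sigma> (cell i) = geom_inv \<alpha> \<sigma> (Qbox (left i) (left i + side i))"
      by (simp add: geom_inv_Qbox cell_def)
    then show ?thesis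
      unfolding Schar_def W_def M_def c_def wmeas_cell volA_cell_powr[OF \<alpha>, symmetric]
      by (intro SUP_upper2[of "(left i, left i + side i)"]) (auto simp: Ivs_def)
  qed
  have "wnorm q \<alpha> (\<lambda>z. ennreal (\<omega> z)) (maxfun \<alpha> \<gamma> (\<lambda>z. ennreal \<bar>\<sigma> z * f z\<bar>))
    \<le> ennreal (two_weight_const p q \<alpha> \<gamma>) * epowr L (1 / p) * epowr (ennreal (8 / t0 \<alpha>)) (1 / p)
      * wnorm p \<alpha> (\<lambda>z. ennreal (\<sigma> z)) (\<lambda>z. ennreal \<bar>f z\<bar>)"
  proof (rule maxfun_two_weight[where a = "\<lambda>i. ennreal (side i powr (2 + \<alpha>)) * inverse (geom_inv \<alpha> \<sigma> (cell i))"])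
    show "sum (\<lambda>i. ennreal (side i powr (2 + \<alpha>)) * inverse (geom_inv \<alpha> \<sigma> (cell i))) G
        \<le> ennreal (8 / t0 \<alpha>) * wmeas \<alpha> (\<lambda>z. ennreal (\<sigma> z)) (cell i)"
      if "finite G" "\<And>j. j \<in> G \<Longrightarrow> fst j = fst i" "\<And>j. j \<in> G \<Longrightarrow> cell j \<subseteq> cell i" for G i
      using that \<sigma> by (intro geometric_carleson[OF \<alpha>]) auto
    show "wmeas \<alpha> (\<lambda>z. ennreal (\<sigma> z)) (cell i) < top" if "wmeas \<alpha> (\<lambda>z. ennreal (\<omega> z)) (cell i) \<noteq> 0" for i
    proof (rule ccontr)
      assume "\<not> wmeas \<alpha> (\<lambda>z. ennreal (\<sigma> z)) (cell i) < top"
      then have "M i = top" by (simp add: M_def less_top[symmetric])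
      with S[of i] that fin geom_inv_neq_0[of \<alpha> \<sigma> "cell i"] show False
        by (simp add: W_def[symmetric] ennreal_mult_top ennreal_top_mult ennreal_top_divide top_unique)
    qed
    show "epowr (wmeas \<alpha> (\<lambda>z. ennreal (\<omega> z)) (cell i)) (p / q) * epowr (wmeas \<alpha> (\<lambda>z. ennreal (\<sigma> z)) (cell i)) p
      \<le> L * (ennreal (side i powr (2 + \<alpha>)) * inverse (geom_inv \<alpha> \<sigma> (cell i))) * ennreal (side i powr ((2 + \<alpha> - \<gamma>) * p))" for i
    proof -
      define x where "x = epowr (W i) (p / q) * epowr (M i) p"
      define g where "g = geom_inv \<alpha> \<sigma> (cell i)"
      have "x / ennreal (c i) \<le> Schar p q \<alpha> \<gamma> \<sigma> \<omega> * inverse g"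
      proof (cases "g = top")
        \<comment> \<open>Now \<open>inverse g\<close> is 0, so the left side has to vanish;
          finiteness of \<open>Schar\<close> ensures it, since a nonzero multiple of
          \<open>top\<close> is \<open>top\<close>.\<close>
        case True
        with S[of i] fin have "x / ennreal (c i) = 0"
          by (auto simp: x_def[symmetric] g_def[symmetric] ennreal_mult_top top_unique split: if_splits)
        then show ?thesis by simp
      next
        case False
        then have "g * inverse g = 1"
          using geom_inv_neq_0[of \<alpha> \<sigma> "cell i"] unfolding g_def
          by (metis divide_ennreal_def ennreal_divide_self top.not_eq_extremum)
        then have "x / ennreal (c i) = x / ennreal (c i) * g * inverse g" by (simp add: mult.assoc)
        also have "\<dots> \<le> Schar p q \<alpha> \<gamma> \<sigma> \<omega> * inverse g"
          using S[of i] by (intro mult_right_mono) (auto simp: x_def g_def)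
        finally show ?thesis .
      qed
      then have "x \<le> Schar p q \<alpha> \<gamma> \<sigma> \<omega> * inverse g * ennreal (c i)"
        using c by (rule ennreal_le_mult_of_divide_le)
      also have "ennreal (c i) = ennreal (v0 \<alpha> powr ?r) * (ennreal (side i powr (2 + \<alpha>)) * ennreal (side i powr ((2 + \<alpha> - \<gamma>) * p)))"
        unfolding c_def r powr_add by (simp add: ennreal_mult)
      finally show ?thesis by (simp add: x_def W_def M_def g_def L_def mult_ac)
    qed
    show "wmeas \<alpha> (\<lambda>z. ennreal \<bar>\<sigma> z * f z\<bar>) (cell i) \<le> wmeas \<alpha> (\<lambda>z. ennreal \<bar>f z\<bar> * ennreal (\<sigma> z)) (cell i)" for i
      using \<sigma> by (simp add: abs_mult ennreal_mult mult.commute)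
  qed (use assms in auto)
  also have "epowr L (1 / p) = epowr (Schar p q \<alpha> \<gamma> \<sigma> \<omega>) (1 / p) * ennreal (v0 \<alpha> powr (1 - \<gamma> / (2 + \<alpha>) + 1 / p))"
    using p by (simp add: L_def epowr_mult powr_powr distrib_right add_divide_distrib)
  finally show ?thesis
    using t0_pos[OF \<alpha>] by (simp add: ennreal_mult two_weight_const_def mult_ac)
qed

lemma two_weight_const_pos: "1 < p \<Longrightarrow> 0 < two_weight_const p q \<alpha> \<gamma>"
  by (simp add: two_weight_const_def)

theorem theorem2p8:
  fixes p q \<alpha> \<gamma> :: real
  assumes "1 < p" "p \<le> q" "-1 < \<alpha>" "0 \<le> \<gamma>" "\<gamma> < 2 + \<alpha>"
  shows "\<exists>C::real. 0 < C \<and>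
    (\<forall>\<sigma> \<omega> (f :: complex \<Rightarrow> real).
      is_weight \<sigma> \<longrightarrow> is_weight \<omega> \<longrightarrow> f \<in> borel_measurable borel \<longrightarrow>
      ((Achar p q \<alpha> \<gamma> \<sigma> \<omega> < top \<and> Binf \<alpha> (\<lambda>z. ennreal (\<sigma> z)) < top \<longrightarrow>
          wnorm q \<alpha> (\<lambda>z. ennreal (\<omega> z)) (maxfun \<alpha> \<gamma> (\<lambda>z. ennreal \<bar>\<sigma> z * f z\<bar>))
            \<le> ennreal C * epowr (Achar p q \<alpha> \<gamma> \<sigma> \<omega>) (1 / p)
                * epowr (Binf \<alpha> (\<lambda>z. ennreal (\<sigma> z))) (1 / p)
                * wnorm p \<alpha> (\<lambda>z. ennreal (\<sigma> z)) (\<lambda>z. ennreal \<bar>f z\<bar>)) \<and>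
       (Cchar p q \<alpha> \<gamma> \<sigma> \<omega> < top \<and> Binf \<alpha> (uw p \<sigma>) < top \<longrightarrow>
          wnorm q \<alpha> (\<lambda>z. ennreal (\<omega> z)) (maxfun \<alpha> \<gamma> (\<lambda>z. ennreal \<bar>f z\<bar>))
            \<le> ennreal C * Cchar p q \<alpha> \<gamma> \<sigma> \<omega>
                * epowr (Binf \<alpha> (uw p \<sigma>)) (1 / p)
                * wnorm p \<alpha> (\<lambda>z. 1) (\<lambda>z. ennreal \<bar>\<sigma> z * f z\<bar>)) \<and>
       (Schar p q \<alpha> \<gamma> \<sigma> \<omega> < top \<longrightarrow>
          wnorm q \<alpha> (\<lambda>z. ennreal (\<omega> z)) (maxfun \<alpha> \<gamma> (\<lambda>z. ennreal \<bar>\<sigma> z * f z\<bar>))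
            \<le> ennreal C * epowr (Schar p q \<alpha> \<gamma> \<sigma> \<omega>) (1 / p)
                * wnorm p \<alpha> (\<lambda>z. ennreal (\<sigma> z)) (\<lambda>z. ennreal \<bar>f z\<bar>))))"
proof -
  define C1 where "C1 = two_weight_const p q \<alpha> \<gamma> * (1 / t0 \<alpha>) powr (1 / p) * v0 \<alpha> powr (1 - \<gamma> / (2 + \<alpha>))"
  define C2 where "C2 = two_weight_const p q \<alpha> \<gamma> * (8 / t0 \<alpha>) powr (1 / p) * v0 \<alpha> powr (1 - \<gamma> / (2 + \<alpha>) + 1 / p)"
  have pos: "0 < C1" "0 < C2"
    using two_weight_const_pos[OF assms(1)] t0_pos[OF assms(3)] v0_pos[OF assms(3)] by (simp_all add: C1_def C2_def)
  \<comment> \<open>The first two bounds share \<open>C1\<close>, so the sum is one constant for all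
    three.\<close>
  have le: "ennreal C1 \<le> ennreal (C1 + C2)" "ennreal C2 \<le> ennreal (C1 + C2)"
    using pos by (auto intro: ennreal_leI)
  note bounds = Achar_bound[OF assms, folded C1_def] Cchar_bound[OF assms, folded C1_def]
    Schar_bound[OF assms, folded C2_def]
  show ?thesis
  proof (intro exI[of _ "C1 + C2"] conjI allI impI)
    show "0 < C1 + C2" using pos by simp
  qed ((elim conjE)?,
      ((rule order_trans[OF bounds(1)], assumption+, intro mult_right_mono le zero_le) |
      (rule order_trans[OF bounds(2)], assumption+, intro mult_right_mono le zero_le) |
      (rule order_trans[OF bounds(3)], assumption+, intro mult_right_mono le zero_le)))+
qed

end
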